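(* For all integers $m,n>0$, $$x^{n-1}\,\mathcal{A}_{m,n,1}\!\left(\frac{x+1}{x},\frac{y+1}{x+1}\right)=\sum_{F\in\mathsf{Flat}_{m,n}}x^{\dim(F)-\mathrm{ssw}(F)}\,y^{\mathrm{ssw}(F)},$$ where $\mathrm{ssw}(F)$ is the number of simple separating walls (of type $x_i-x_{i+1}=m$) of the flat $F$.
   Context: Polynomial: $\mathcal{A}_{m,n,1}(x,y)=\sum_P x^{\mathrm{val}(P,m)}y^{\mathrm{ret}(P)}$, the sum over all $(m,1)$-Dyck paths $P$ of height $n$, i.e. lattice paths from $(0,0)$ to $(mn,n)$ with steps $N=(0,1)$, $E=(1,0)$ that start with a north step and never go below $x=my$ (all lattice points $(p,q)$ on $P$ satisfy $p\le mq$). A valley is a lattice point on $P$ preceded by an east step and followed by a north step; $\mathrm{val}(P,m)$ is the number of valleys with $x$-coordinate divisible by $m$; $\mathrm{ret}(P)$ is the number of returns, i.e. valleys of the form $(mi,i)$ with $1\le i\le n-1$. Arrangement: the $m$-Catalan arrangement of type $A_{n-1}$ consists of the hyperplanes $x_i-x_j=k$, $1\le i<j\le n$, $-m\le k\le m$. Dimensions are taken in the $(n-1)$-dimensional space $\{x_1+\cdots+x_n=0\}$, so that regions have dimension $n-1$. Dominant regions are the regions contained in the cone $x_1>x_2>\cdots>x_n$. A wall of a region $R$ is a hyperplane of the arrangement supporting a facet of $R$; it is a separating wall if it separates $R$ from the origin. A simple separating wall of $R$ is a separating wall of type $x_i-x_{i+1}=m$. Flats: $\mathsf{Flat}_{m,n}$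 is the set of all non-empty sets obtained by intersecting, over all $1\le i<j\le n$: the half-space $x_i-x_j>0$; for each $k=1,\ldots,m-1$ exactly one of the open half-spaces $x_i-x_j>k$, $x_i-x_j<k$; and exactly one of $x_i-x_j>m$, $x_i-x_j<m$, $x_i-x_j=m$. For $F\in\mathsf{Flat}_{m,n}$ let $S$ be the set of hyperplanes $x_i-x_j=m$ containing $F$, and let $R$ be the dominant region obtained from the description of $F$ by replacing each condition $x_i-x_j=m$ by $x_i-x_j>m$. (The map $F\mapsto(R,S)$ is known to be a bijection from $\mathsf{Flat}_{m,n}$ to the set of pairs $(R,S)$ with $R$ a dominant region and $S$ a subset of its separating walls of type $x_i-x_j=m$.) The simple separating walls of $F$ are the simple separating walls of $R$ that are not in $S$. *)

theory Defs
  imports "HOL-Analysis.Analysis"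
begin

section \<open>Dyck paths\<close>

datatype step = North | East

text \<open>The lattice point reached after the first \<open>l\<close> steps of the path \<open>P\<close> from the origin.\<close>

definition lattice_point :: "step list \<Rightarrow> nat \<Rightarrow> nat \<times> nat" where
  "lattice_point P l = (count_list (take l P) East, count_list (take l P) North)"

definition dyck_paths :: "nat \<Rightarrow> nat \<Rightarrow> step list set" where
  "dyck_paths m n =
     {P. lattice_point P (length P) = (m * n, n) \<and> P \<noteq> [] \<and> hd P = North \<and>
         (\<forall>l \<le> length P. fst (lattice_point P l) \<le> m * snd (lattice_point P l))}"

definition valleys :: "step list \<Rightarrow> (nat \<times> nat) set" where
  "valleys P =
     {lattice_point P l |l. 0 < l \<and> l < length P \<and> P ! (l - 1) = East \<and> P ! l = North}"

definition val_count :: "step list \<Rightarrow> nat \<Rightarrow> nat" where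
  "val_count P m = card {v \<in> valleys P. m dvd fst v}"

definition ret_count :: "nat \<Rightarrow> nat \<Rightarrow> step list \<Rightarrow> nat" where
  "ret_count m n P = card {v \<in> valleys P. \<exists>i\<in>{1..n - 1}. v = (m * i, i)}"

definition dyck_poly :: "nat \<Rightarrow> nat \<Rightarrow> 'a::comm_semiring_1 \<Rightarrow> 'a \<Rightarrow> 'a" where
  "dyck_poly m n x y = (\<Sum>P\<in>dyck_paths m n. x ^ val_count P m * y ^ ret_count m n P)"

lemma finite_dyck_paths: "finite (dyck_paths m n)"
proof (rule finite_subset)
  have len: "length P = count_list P East + count_list P North" for P
  proof (induction P)
    case (Cons a P)
    then show ?case by (cases a) auto
  qed simp
  have "(UNIV :: step set) = {North, East}"
    using step.exhaust by auto
  then have fin: "finite (UNIV :: step set)"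
    by (metis finite.emptyI finite.insertI)
  show "dyck_paths m n \<subseteq> {P. set P \<subseteq> UNIV \<and> length P = m * n + n}"
    by (auto simp: dyck_paths_def lattice_point_def len)
  show "finite {P :: step list. set P \<subseteq> UNIV \<and> length P = m * n + n}"
    by (rule finite_lists_length_eq[OF fin])
qed


section \<open>The Catalan arrangement and its flats\<close>

text \<open>
  Coordinates are indexed by a finite linearly ordered type \<open>'n\<close>, whose elements in increasing
  order play the role of \<open>1, \<dots>, n\<close> with \<open>n = CARD('n)\<close>. The ambient space is the subspace
  \<open>sum_zero\<close> of \<open>real ^ 'n\<close>, of dimension \<open>n - 1\<close>.
\<close>

definition sum_zero :: "(real ^ 'n) set" where
  "sum_zero = {x. (\<Sum>i\<in>UNIV. x $ i) = 0}"

definition hyp :: "'n \<Rightarrow> 'n \<Rightarrow> int \<Rightarrow> (real ^ 'n) set" where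
  "hyp i j k = {x \<in> sum_zero. x $ i - x $ j = of_int k}"

definition catalan_arrangement :: "nat \<Rightarrow> (real ^ 'n::{finite,linorder}) set set" where
  "catalan_arrangement m = {hyp i j k |i j k. i < j \<and> - int m \<le> k \<and> k \<le> int m}"

definition is_wall :: "nat \<Rightarrow> (real ^ 'n::{finite,linorder}) set \<Rightarrow> (real ^ 'n::{finite,linorder}) set \<Rightarrow> bool" where
  "is_wall m R H \<longleftrightarrow> H \<in> catalan_arrangement m \<and> (H \<inter> closure R) facet_of (closure R)"

text \<open>The hyperplane \<open>hyp i j k\<close> strictly separates \<open>R\<close> from the origin.\<close>

definition separates_origin :: "(real ^ 'n) set \<Rightarrow> 'n \<Rightarrow> 'n \<Rightarrow> int \<Rightarrow> bool" where
  "separates_origin R i j k \<longleftrightarrow>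
     (0 < k \<and> (\<forall>x\<in>R. x $ i - x $ j > of_int k)) \<or> (k < 0 \<and> (\<forall>x\<in>R. x $ i - x $ j < of_int k))"

definition consecutive :: "'n::linorder \<Rightarrow> 'n \<Rightarrow> bool" where
  "consecutive i j \<longleftrightarrow> i < j \<and> \<not> (\<exists>k. i < k \<and> k < j)"

definition simple_separating_walls ::
    "nat \<Rightarrow> (real ^ 'n::{finite,linorder}) set \<Rightarrow> (real ^ 'n::{finite,linorder}) set set" where
  "simple_separating_walls m R =
     {hyp i j (int m) |i j. consecutive i j \<and> is_wall m R (hyp i j (int m)) \<and>
                            separates_origin R i j (int m)}"

text \<open>
  A description assigns to \<open>i < j\<close> and \<open>1 \<le> k \<le> m\<close> the sign \<open>s i j k\<close> of \<open>x\<^sub>i - x\<^sub>j - k\<close>: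
  \<open>1\<close>, \<open>-1\<close>, \<open>0\<close> select \<open>x\<^sub>i - x\<^sub>j > k\<close>, \<open>x\<^sub>i - x\<^sub>j < k\<close>, \<open>x\<^sub>i - x\<^sub>j = k\<close>, the last being
  permitted only for \<open>k = m\<close>. Values of \<open>s\<close> at other arguments are irrelevant.
\<close>

type_synonym 'n description = "'n \<Rightarrow> 'n \<Rightarrow> nat \<Rightarrow> real"

definition admissible :: "nat \<Rightarrow> 'n::linorder description \<Rightarrow> bool" where
  "admissible m s \<longleftrightarrow>
     (\<forall>i j. i < j \<longrightarrow> (\<forall>k\<in>{1..<m}. s i j k \<in> {1, -1}) \<and> s i j m \<in> {1, -1, 0})"

definition cell :: "nat \<Rightarrow> 'n::{finite,linorder} description \<Rightarrow> (real ^ 'n::{finite,linorder}) set" where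
  "cell m s =
     {x \<in> sum_zero. \<forall>i j. i < j \<longrightarrow>
        x $ i - x $ j > 0 \<and> (\<forall>k\<in>{1..m}. sgn (x $ i - x $ j - real k) = s i j k)}"

definition Flat :: "nat \<Rightarrow> (real ^ 'n::{finite,linorder}) set set" where
  "Flat m = {cell m s |s. admissible m s \<and> cell m s \<noteq> {}}"

definition equalities_to_greater :: "'n description \<Rightarrow> 'n description" where
  "equalities_to_greater s = (\<lambda>i j k. if s i j k = 0 then 1 else s i j k)"

text \<open>
  The result does not depend on the chosen description of \<open>F\<close>; see \<open>region_of_cell\<close>.
\<close>

definition region_of :: "nat \<Rightarrow> (real ^ 'n::{finite,linorder}) set \<Rightarrow> (real ^ 'n::{finite,linorder}) set" where
  "region_of m F =
     cell m (equalities_to_greater (SOME s. admissible m s \<and> cell m s = F))"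

definition containing_hyps :: "nat \<Rightarrow> (real ^ 'n::{finite,linorder}) set \<Rightarrow> (real ^ 'n::{finite,linorder}) set set" where
  "containing_hyps m F = {hyp i j (int m) |i j. i < j \<and> F \<subseteq> hyp i j (int m)}"

definition ssw :: "nat \<Rightarrow> (real ^ 'n::{finite,linorder}) set \<Rightarrow> nat" where
  "ssw m F = card (simple_separating_walls m (region_of m F) - containing_hyps m F)"

lemma region_of_cell:
  fixes s :: "'n::{finite,linorder} description"
  assumes "admissible m s" "cell m s \<noteq> {}"
  shows "region_of m (cell m s) = cell m (equalities_to_greater s)"
proof -
  define t where "t = (SOME t. admissible m t \<and> cell m t = cell m s)"
  have t: "cell m t = cell m s"
    unfolding t_def using someI[of "\<lambda>t. admissible m t \<and> cell m t = cell m s" s] assms by blast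
  obtain x where "x \<in> cell m s" "x \<in> cell m t"
    using assms t by auto
  then have eq: "t i j k = s i j k" if "i < j" "k \<in> {1..m}" for i j k
    using that unfolding cell_def by fastforce
  have "cell m (equalities_to_greater t) = cell m (equalities_to_greater s)"
    unfolding cell_def equalities_to_greater_def using eq by auto
  then show ?thesis
    by (simp add: region_of_def t_def)
qed

lemma finite_Flat: "finite (Flat m :: (real ^ 'n::{finite,linorder}) set set)"
proof -
  let ?A = "UNIV \<times> UNIV \<times> {1..m} \<times> {1, -1, 0 :: real} :: ('n \<times> 'n \<times> nat \<times> real) set"
  let ?g = "\<lambda>T. {x \<in> sum_zero :: (real ^ 'n::{finite,linorder}) set. \<forall>i j. i < j \<longrightarrow>
        x $ i - x $ j > 0 \<and> (\<forall>k\<in>{1..m}. (i, j, k, sgn (x $ i - x $ j - real k)) \<in> T)}"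
  have "cell m s \<in> ?g ` Pow ?A" for s :: "'n description"
  proof (rule image_eqI)
    let ?T = "{(i, j, k, r) \<in> ?A. r = s i j k}"
    have "sgn r \<in> {1, -1, 0}" for r :: real
      by (auto simp: sgn_if)
    then show "cell m s = ?g ?T"
      unfolding cell_def by auto
    show "?T \<in> Pow ?A" by auto
  qed
  then have "Flat m \<subseteq> ?g ` Pow ?A"
    unfolding Flat_def by blast
  moreover have "finite (?g ` Pow ?A)"
    by (intro finite_imageI finite_Pow_iff[THEN iffD2] finite_cartesian_product) auto
  ultimately show ?thesis
    by (rule finite_subset)
qed

end

theory Submission
  imports Defs
begin

text \<open>
  Put \<open>t = 1 / x\<close> and \<open>u = y / x\<close>. After division by \<open>x ^ (n - 1)\<close> a path has weight \<open>1 + t\<close> for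
  every counted valley that is not a return and \<open>t + u\<close> for every return, while a flat has weight
  \<open>t\<close> for every equation \<open>x\<^sub>i - x\<^sub>j = m\<close> and \<open>u\<close> for every simple separating wall.

  A path is built from left to right: before each north step one chooses how many of the pending
  east steps to take. A flat is built by inserting the coordinates in increasing order: a new
  coordinate is placed relative to the pending values \<open>x\<^sub>j + k\<close>, \<open>1 \<le> k \<le> m\<close>, above the current
  maximum, either in a gap or, for \<open>k = m\<close>, on a value. In both processes each step removes the
  choices up to the selected one and adds \<open>m + 1\<close> new ones, of which exactly one is special
  (\<open>m\<close> divides the abscissa, respectively \<open>k = m\<close>). The special choices sit at different positions
  in the two processes, but the weighted number of continuations depends only on how many there
  are (\<open>slot_sum_cong_mset\<close>), so both sides equal the same \<open>slot_sum\<close>.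
\<close>

section \<open>A transfer recursion\<close>

text \<open>
  \<open>L\<close> lists the weights of the available choices in order, except for the last choice of all, which
  has weight \<open>v\<close>. Selecting it uses up all of \<open>L\<close>. If another choice is selected, the old last choice
  becomes an ordinary one of weight \<open>s\<close>; this is the \<open>s\<close> in the third equation.
\<close>

fun slot_sum :: "nat \<Rightarrow> 'a::comm_semiring_1 \<Rightarrow> 'a \<Rightarrow> nat \<Rightarrow> 'a list \<Rightarrow> 'a" where
  "slot_sum m s v 0 L = 1"
| "slot_sum m s v (Suc r) [] = v * slot_sum m s v r (replicate m 1)"
| "slot_sum m s v (Suc r) (w # L) =
     w * slot_sum m s v r (L @ s # replicate m 1) + slot_sum m s v (Suc r) L"

text \<open>Taking \<open>a\<close> leaves \<open>b\<close> available, while taking \<open>b\<close>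
  discards \<open>a\<close>. Unfolding twice still gives an expression symmetric in both: each can
  be taken alone, or both in succession, with the same list afterwards.\<close>

lemma slot_sum_swap: "slot_sum m s v r (a # b # L) = slot_sum m s v r (b # a # L)"
proof (cases r)
  case (Suc q)
  then show ?thesis by (cases q) (auto simp: algebra_simps)
qed simp

text \<open>Adjacent swaps reach every ordering. The outer induction on \<open>r\<close> permits
  reordering the lists left after a choice; the inner ones move a given entry to the front and match
  the lists entry by entry.\<close>

lemma slot_sum_cong_mset:
  "mset L = mset L' \<Longrightarrow> slot_sum m s v r L = slot_sum m s v r L'"
proof (induction r arbitrary: L L')
  case (Suc r)
  have front: "slot_sum m s v (Suc r) L = slot_sum m s v (Suc r) (w # remove1 w L)"
    if "w \<in> set L" for w L
    using that
  proof (induction L)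
    case (Cons a L)
    show ?case
    proof (cases "a = w")
      case False
      then have w: "w \<in> set L" using Cons.prems by auto
      have "slot_sum m s v r (L @ s # replicate m 1) =
          slot_sum m s v r ((w # remove1 w L) @ s # replicate m 1)"
        by (rule Suc.IH) (use w in simp)
      then have "slot_sum m s v (Suc r) (a # L) = slot_sum m s v (Suc r) (a # w # remove1 w L)"
        using Cons.IH[OF w] by simp
      then show ?thesis
        using False slot_sum_swap[of m s v "Suc r" a w] by simp
    qed simp
  qed simp
  show ?case
    using Suc.prems
  proof (induction L arbitrary: L')
    case (Cons w T)
    then have w: "w \<in> set L'"
      by (metis list.set_intros(1) set_mset_mset)
    have T: "mset T = mset (remove1 w L')"
      using Cons.prems by (metis add_mset_remove_trivial mset.simps(2) mset_remove1)
    have "slot_sum m s v r (T @ s # replicate m 1) =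
        slot_sum m s v r (remove1 w L' @ s # replicate m 1)"
      by (rule Suc.IH) (use T in simp)
    then show ?case
      using Cons.IH[OF T] front[OF w] by simp
  qed simp
qed simp

text \<open>The recursion unrolled over all choices \<open>p\<close>, the form in which both models
  meet it: taking \<open>p\<close> keeps exactly the later positions. The separate first summand is
  the unlisted last choice.\<close>

lemma slot_sum_Suc_sorted:
  assumes "finite A"
  shows "slot_sum m s v (Suc r) (map f (sorted_list_of_set A)) =
     v * slot_sum m s v r (replicate m 1) +
     (\<Sum>p\<in>A. f p * slot_sum m s v r
        (map f (sorted_list_of_set {q \<in> A. p < q}) @ s # replicate m 1))"
  using assms
proof (induction A rule: finite_linorder_min_induct)
  case (insert b A)
  have b: "b \<notin> A" using insert.hyps by auto
  have "sorted_list_of_set (insert b A) = b # sorted_list_of_set A"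
    using insert.hyps b
    by (auto simp: sorted_list_of_set_insert_remove insort_is_Cons less_imp_le)
  moreover have "{q \<in> insert b A. b < q} = A"
    using insert.hyps by auto
  moreover have "{q \<in> insert b A. p < q} = {q \<in> A. p < q}" if "p \<in> A" for p
    using insert.hyps that by auto
  ultimately show ?case
    using insert.IH insert.hyps b by (simp add: add_ac)
qed simp

lemma mset_map_sorted_list_of_set: "mset (map f (sorted_list_of_set A)) = image_mset f (mset_set A)"
  by (metis mset_map mset_sorted_list_of_multiset sorted_list_of_mset_set)

section \<open>Dyck paths\<close>

text \<open>The step just taken is carried along, so that a valley at the current point is
  recognised when the next step is read.\<close>

fun valleys_from :: "step \<Rightarrow> nat \<times> nat \<Rightarrow> step list \<Rightarrow> (nat \<times> nat) set" where
  "valleys_from a p [] = {}"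
| "valleys_from a (e, j) (East # w) = valleys_from East (Suc e, j) w"
| "valleys_from a (e, j) (North # w) =
     (if a = East then {(e, j)} else {}) \<union> valleys_from North (e, Suc j) w"

lemma lattice_point_Cons:
  "lattice_point (a # w) (Suc l) = (fst (lattice_point w l) + (if a = East then 1 else 0),
     snd (lattice_point w l) + (if a = North then 1 else 0))"
  by (auto simp: lattice_point_def)

lemma valleys_from_eq:
  "valleys_from a (e, j) w =
     {(e + fst (lattice_point w l), j + snd (lattice_point w l)) |l.
        l < length w \<and> (a # w) ! l = East \<and> w ! l = North}"
proof (induction w arbitrary: a e j)
  case (Cons b w)
  have *: "{f l |l. l < length (b # w) \<and> (a # b # w) ! l = East \<and> (b # w) ! l = North} =
      (if a = East \<and> b = North then {f 0} else {}) \<union>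
      {f (Suc l) |l. l < length w \<and> (b # w) ! l = East \<and> w ! l = North}"
    for f :: "nat \<Rightarrow> nat \<times> nat"
  proof -
    have "Q (l::nat) \<longleftrightarrow> (l = 0 \<and> Q 0) \<or> (\<exists>k. l = Suc k \<and> Q (Suc k))" for Q l
      by (cases l) auto
    note split = this
    show ?thesis
      by (subst split[of "\<lambda>l. l < length (b # w) \<and> (a # b # w) ! l = East \<and> (b # w) ! l = North"]) auto
  qed
  show ?case
    unfolding *
    by (cases b) (simp_all add: Cons.IH lattice_point_Cons, simp_all add: lattice_point_def)
qed simp

lemma valleys_eq: 
  assumes "P = North # w"
  shows "valleys P = valleys_from North (0, 1) w"
proof -
  have "valleys P = {lattice_point P (Suc l) |l. l < length w \<and> P ! l = East \<and> w ! l = North}"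
    unfolding valleys_def assms
    by (rule Collect_cong) (metis Suc_less_eq diff_Suc_1 gr0_conv_Suc length_Cons nth_Cons_Suc zero_less_Suc)
  then show ?thesis
    by (simp add: valleys_from_eq assms lattice_point_Cons)
qed

lemma valleys_from_ge: "v \<in> valleys_from a (e, j) w \<Longrightarrow> j \<le> snd v"
  by (auto simp: valleys_from_eq)

lemma finite_valleys_from: "finite (valleys_from a p w)"
  by (induction a p w rule: valleys_from.induct) auto

lemma valleys_from_East_run:
  "valleys_from North (e, j) (replicate p East @ w) = valleys_from (if p = 0 then North else East) (e + p, j) w"
proof -
  have "valleys_from a (e, j) (replicate p East @ w) = valleys_from (if p = 0 then a else East) (e + p, j) w" for a
    by (induction p arbitrary: a e) auto
  then show ?thesis .
qed

text \<open>Continuations of a path that has just reached \<open>(e, j)\<close> by a north step and has \<open>r\<close> north steps left.\<close>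

fun tails :: "nat \<Rightarrow> nat \<Rightarrow> nat \<Rightarrow> nat \<Rightarrow> step list set" where
  "tails m 0 j e = {replicate (m * j - e) East}"
| "tails m (Suc r) j e =
     (\<Union>p\<in>{e..m * j}. (\<lambda>w. replicate (p - e) East @ North # w) ` tails m r (Suc j) p)"

section \<open>Dyck paths as words built one north step at a time\<close>

fun stays :: "nat \<Rightarrow> nat \<Rightarrow> nat \<Rightarrow> step list \<Rightarrow> bool" where
  "stays m e j [] \<longleftrightarrow> e \<le> m * j"
| "stays m e j (East # w) \<longleftrightarrow> e \<le> m * j \<and> stays m (Suc e) j w"
| "stays m e j (North # w) \<longleftrightarrow> e \<le> m * j \<and> stays m e (Suc j) w"

lemma stays_iff:
  "stays m e j w \<longleftrightarrow>
     (\<forall>l\<le>length w. e + fst (lattice_point w l) \<le> m * (j + snd (lattice_point w l)))"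
proof (induction w arbitrary: e j)
  case (Cons a w)
  have "(\<forall>l\<le>length (a # w). Q l) \<longleftrightarrow> Q 0 \<and> (\<forall>l\<le>length w. Q (Suc l))" for Q :: "nat \<Rightarrow> bool"
    by (metis Suc_le_mono length_Cons not0_implies_Suc zero_le)
  note split = this
  show ?case
    by (subst split, cases a) (simp_all add: Cons.IH lattice_point_Cons, simp_all add: lattice_point_def)
qed (simp add: lattice_point_def)

lemma stays_start: "stays m e j w \<Longrightarrow> e \<le> m * j"
  by (cases "(m, e, j, w)" rule: stays.cases) auto

text \<open>Along an east run the bound is tightest at its end, where the remaining word checks
  it.\<close>

lemma stays_East_run:
  "stays m e j (replicate p East @ w) \<longleftrightarrow> stays m (e + p) j w"
  by (induction p arbitrary: e) (auto dest: stays_start)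

lemma count_list_replicate: "count_list (replicate k x) y = (if x = y then k else 0)"
  by (induction k) auto

lemma no_North_eq_replicate:
  "count_list w North = 0 \<Longrightarrow> w = replicate (count_list w East) East"
proof (induction w)
  case (Cons a w)
  then show ?case by (cases a) auto
qed simp

lemma split_first_North:
  assumes "count_list w North = Suc r"
  obtains p w' where "w = replicate p East @ North # w'"
proof -
  have "\<exists>p w'. w = replicate p East @ North # w'"
    using assms
  proof (induction w)
    case (Cons a w)
    show ?case
    proof (cases a)
      case North
      then show ?thesis by (metis append_Nil replicate_0)
    next
      case East
      then obtain p w' where "w = replicate p East @ North # w'" using Cons by auto
      then show ?thesis using East by (metis append_Cons replicate_Suc)
    qed
  qed simp
  then show ?thesis using that by blast
qed

lemma East_run_inject:
  "replicate a East @ North # w = replicate b East @ North # w' \<longleftrightarrow> a = b \<and> w = w'"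
proof (induction a arbitrary: b)
  case 0
  show ?case by (cases b) auto
next
  case (Suc a)
  show ?case by (cases b) (auto simp: Suc.IH)
qed

text \<open>Cuts the word at its first north step: the abscissa at which row \<open>j\<close> is
  left is then the only free choice. The hypothesis makes the truncated difference
  \<open>m * j - e\<close> exact.\<close>

lemma tails_iff:
  assumes "e \<le> m * j"
  shows "w \<in> tails m r j e \<longleftrightarrow>
    stays m e j w \<and> e + count_list w East = m * (j + r) \<and> count_list w North = r"
  using assms
proof (induction r arbitrary: j e w)
  case 0
  have "stays m e j (replicate (m * j - e) East)"
    using stays_East_run[of m e j "m * j - e" "[]"] 0 by simp
  moreover have "w = replicate (m * j - e) East"
    if "e + count_list w East = m * j" "count_list w North = 0"
    using no_North_eq_replicate[OF that(2)] that(1) by (metis add_diff_cancel_left')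
  ultimately show ?case
    using 0 by (auto simp: count_list_replicate)
next
  case (Suc r)
  show ?case (is "_ \<longleftrightarrow> ?R")
  proof
    assume "w \<in> tails m (Suc r) j e"
    then obtain p w' where *: "e \<le> p" "p \<le> m * j" "w' \<in> tails m r (Suc j) p"
        "w = replicate (p - e) East @ North # w'"
      by auto
    have "p \<le> m * Suc j" using *(2) by simp
    from Suc.IH[OF this] * show ?R
      by (auto simp: stays_East_run count_list_replicate)
  next
    assume R: ?R
    then obtain k w' where w: "w = replicate k East @ North # w'"
      using split_first_North by blast
    have le: "e + k \<le> m * j" and st: "stays m (e + k) (Suc j) w'"
      using R by (auto simp: w stays_East_run)
    have "e + k \<le> m * Suc j" using le by simp
    from Suc.IH[OF this] have "w' \<in> tails m r (Suc j) (e + k)"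
      using st R by (auto simp: w count_list_replicate)
    then show "w \<in> tails m (Suc r) j e"
      using le unfolding w by (auto intro!: bexI[of _ "e + k"])
  qed
qed

lemma finite_tails: "finite (tails m r j e)"
  by (induction m r j e rule: tails.induct) auto

lemma dyck_paths_eq:
  assumes "n > 0"
  shows "dyck_paths m n = (#) North ` tails m (n - 1) 1 0"
proof -
  have "P \<in> dyck_paths m n \<longleftrightarrow> (\<exists>w. P = North # w \<and> w \<in> tails m (n - 1) 1 0)" for P
  proof (cases P)
    case (Cons a w)
    have *: "(\<forall>l\<le>length P. fst (lattice_point P l) \<le> m * snd (lattice_point P l)) \<longleftrightarrow> stays m 0 0 P"
      by (simp add: stays_iff)
    show ?thesis
      unfolding dyck_paths_def mem_Collect_eq *
      using assms by (cases a) (auto simp: Cons tails_iff lattice_point_def)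
  qed (simp add: dyck_paths_def)
  then show ?thesis by blast
qed

section \<open>Weighted sums over the continuations of a path\<close>

lemma sum_tails_Suc:
  "(\<Sum>w\<in>tails m (Suc r) j e. h w) =
     (\<Sum>p\<in>{e..m * j}. \<Sum>w\<in>tails m r (Suc j) p. h (replicate (p - e) East @ North # w))"
proof -
  have "(\<Sum>w\<in>tails m (Suc r) j e. h w) =
      (\<Sum>p\<in>{e..m * j}. \<Sum>w\<in>(\<lambda>w. replicate (p - e) East @ North # w) ` tails m r (Suc j) p. h w)"
    unfolding tails.simps
    by (rule sum.UNION_disjoint) (auto simp: finite_tails East_run_inject)
  also have "\<dots> = (\<Sum>p\<in>{e..m * j}. \<Sum>w\<in>tails m r (Suc j) p. h (replicate (p - e) East @ North # w))"
    by (rule sum.cong[OF refl]) (simp add: sum.reindex inj_on_def East_run_inject)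
  finally show ?thesis .
qed

text \<open>A return also has an abscissa divisible by \<open>m\<close>, so \<open>v\<close> stands
  for the product of both contributions.\<close>

definition valley_weight :: "nat \<Rightarrow> 'a::comm_semiring_1 \<Rightarrow> 'a \<Rightarrow> nat \<times> nat \<Rightarrow> 'a" where
  "valley_weight m s v p = (if fst p = m * snd p then v else if m dvd fst p then s else 1)"

text \<open>The entry for \<open>q\<close> stands for leaving row \<open>j\<close> at abscissa \<open>q\<close>; \<open>q = e\<close> creates no valley.\<close>

definition path_slots :: "nat \<Rightarrow> 'a::comm_semiring_1 \<Rightarrow> nat \<Rightarrow> nat \<Rightarrow> 'a list" where
  "path_slots m s j e =
     map (\<lambda>q. if q = e then 1 else if m dvd q then s else 1) (sorted_list_of_set {e..<m * j})"

lemma no_multiple_between: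
  fixes m j q :: nat
  assumes "m * j < q" "q < m * Suc j"
  shows "\<not> m dvd q"
proof
  assume "m dvd q"
  then obtain k where "q = m * k" by auto
  then show False using assms
    by (metis less_Suc_eq_le mult_less_cancel1 not_less)
qed

text \<open>After a return the row is entered at the multiple \<open>m * j\<close>, but leaving it
  there makes no valley; the other slots are not at multiples of \<open>m\<close>.\<close>

lemma mset_path_slots_return:
  assumes "m > 0"
  shows "mset (path_slots m s (Suc j) (m * j)) = replicate_mset m 1"
proof -
  have "image_mset (\<lambda>q. if q = m * j then 1 else if m dvd q then s else 1) (mset_set {m * j..<m * Suc j}) =
      image_mset (\<lambda>q. 1) (mset_set {m * j..<m * Suc j})"
    by (rule image_mset_cong) (use no_multiple_between[of m j] in \<open>fastforce simp: le_less\<close>)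
  also have "\<dots> = replicate_mset m 1"
    by (simp add: image_mset_const_eq)
  finally show ?thesis
    unfolding path_slots_def by (simp only: mset_map_sorted_list_of_set)
qed

text \<open>The next row keeps the slots beyond \<open>p\<close>, turns the former last one
  \<open>m * j\<close> into a slot of weight \<open>s\<close> and adds \<open>m - 1\<close>
  non-multiples. Together with \<open>p\<close> itself, where leaving makes no valley, these give
  the \<open>m\<close> ones.\<close>

lemma mset_path_slots_Suc:
  assumes "e \<le> p" "p < m * j"
  shows "mset (path_slots m s (Suc j) p) =
    mset (map (\<lambda>q. if q = e then 1 else if m dvd q then s else 1)
       (sorted_list_of_set {q \<in> {e..<m * j}. p < q}) @ s # replicate m 1)"
proof -
  let ?f = "\<lambda>e q. if q = e then 1 else if m dvd q then s else 1"
  obtain m' where m: "m = Suc m'" using assms by (cases m) auto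
  have "{p..<m * Suc j} = insert p (insert (m * j) ({q \<in> {e..<m * j}. p < q} \<union> {m * j<..<m * Suc j}))"
    using assms m by auto
  moreover have "mset_set ({q \<in> {e..<m * j}. p < q} \<union> {m * j<..<m * Suc j}) =
      mset_set {q \<in> {e..<m * j}. p < q} + mset_set {m * j<..<m * Suc j}"
    by (rule mset_set_Union) auto
  ultimately have "mset_set {p..<m * Suc j} = {#p#} + mset_set {q \<in> {e..<m * j}. p < q} + {#m * j#}
      + mset_set {m * j<..<m * Suc j}"
    using assms by (simp del: mult_Suc_right)
  moreover have "image_mset (?f p) (mset_set {q \<in> {e..<m * j}. p < q}) =
      image_mset (?f e) (mset_set {q \<in> {e..<m * j}. p < q})"
    by (rule image_mset_cong) (use assms in auto)
  moreover have "image_mset (?f p) (mset_set {m * j<..<m * Suc j}) =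
      image_mset (\<lambda>q. 1) (mset_set {m * j<..<m * Suc j})"
    by (rule image_mset_cong) (use no_multiple_between[of m j] assms in auto)
  ultimately have "image_mset (?f p) (mset_set {p..<m * Suc j}) =
      {#1#} + image_mset (?f e) (mset_set {q \<in> {e..<m * j}. p < q}) + {#s#} + replicate_mset m' 1"
    using assms m dvd_triv_left[of m j] by (simp add: image_mset_const_eq)
  then show ?thesis
    unfolding path_slots_def by (simp only: mset_map_sorted_list_of_set mset_append mset.simps) (simp add: m)
qed

text \<open>Leaving row \<open>j\<close> at abscissa \<open>p\<close> amounts to selecting slot
  \<open>p\<close>, with the return \<open>p = m * j\<close> as the last choice. The next row is
  entered at \<open>p < m * Suc j\<close>, so the strict hypothesis persists.\<close>

lemma sum_tails_valley_weight:
  assumes "m > 0" "e < m * j"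
  shows "(\<Sum>w\<in>tails m r j e. \<Prod>p\<in>valleys_from North (e, j) w. valley_weight m s v p) =
    slot_sum m s v r (path_slots m s j e)"
  using assms(2)
proof (induction r arbitrary: j e)
  case 0
  have "valleys_from North (e, j) (replicate (m * j - e) East) = {}"
    using valleys_from_East_run[of e j "m * j - e" "[]"] by simp
  then show ?case by simp
next
  case (Suc r)
  let ?f = "\<lambda>q. if q = e then 1 else if m dvd q then s else 1"
  let ?W = "\<lambda>j e w. \<Prod>p\<in>valleys_from North (e, j) w. valley_weight m s v p"
  have W: "?W j e (replicate (p - e) East @ North # w) =
      (if p = e then 1 else valley_weight m s v (p, j)) * ?W (Suc j) p w" if "e \<le> p" for p w
  proof -
    \<comment> \<open>Later valleys lie in higher rows, so the factor of \<open>(p, j)\<close>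
      splits off.\<close>
    have "(p, j) \<notin> valleys_from North (p, Suc j) w"
      using valleys_from_ge by fastforce
    then show ?thesis
      using that by (simp add: valleys_from_East_run finite_valleys_from)
  qed
  have IH: "(\<Sum>w\<in>tails m r (Suc j) p. ?W (Suc j) p w) = slot_sum m s v r (path_slots m s (Suc j) p)"
    if "p \<le> m * j" for p
    by (rule Suc.IH) (use that assms(1) in auto)
  have "(\<Sum>w\<in>tails m (Suc r) j e. ?W j e w) =
      (\<Sum>p\<in>{e..m * j}. (if p = e then 1 else valley_weight m s v (p, j)) *
          slot_sum m s v r (path_slots m s (Suc j) p))"
    unfolding sum_tails_Suc
    by (intro sum.cong refl) (simp add: W IH flip: sum_distrib_left)
  also have "\<dots> = v * slot_sum m s v r (path_slots m s (Suc j) (m * j)) +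
      (\<Sum>p\<in>{e..<m * j}. (if p = e then 1 else valley_weight m s v (p, j)) *
          slot_sum m s v r (path_slots m s (Suc j) p))"
  proof -
    \<comment> \<open>Since \<open>e < m * j\<close>, the last choice differs from \<open>e\<close>
      and does create a valley, which is a return.\<close>
    have "{e..m * j} = insert (m * j) {e..<m * j}" using Suc.prems by auto
    then show ?thesis using Suc.prems by (simp add: valley_weight_def)
  qed
  also have "slot_sum m s v r (path_slots m s (Suc j) (m * j)) = slot_sum m s v r (replicate m 1)"
    by (rule slot_sum_cong_mset) (simp add: mset_path_slots_return assms)
  also have "(\<Sum>p\<in>{e..<m * j}. (if p = e then 1 else valley_weight m s v (p, j)) *
          slot_sum m s v r (path_slots m s (Suc j) p)) =
      (\<Sum>p\<in>{e..<m * j}. ?f p * slot_sum m s v r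
        (map ?f (sorted_list_of_set {q \<in> {e..<m * j}. p < q}) @ s # replicate m 1))"
    by (intro sum.cong refl arg_cong2[where f = "(*)"] slot_sum_cong_mset mset_path_slots_Suc)
      (auto simp: valley_weight_def)
  finally show ?case
    unfolding path_slots_def by (simp only: slot_sum_Suc_sorted[OF finite_atLeastLessThan])
qed

lemma dyck_poly_eq_slot_sum:
  fixes X Y :: "'a::comm_semiring_1"
  assumes "m > 0" "n > 0"
  shows "dyck_poly m n X Y = slot_sum m X (X * Y) (n - 1) (replicate m 1)"
proof -
  have w: "X ^ val_count P m * Y ^ ret_count m n P =
      (\<Prod>p\<in>valleys_from North (0, 1) w. valley_weight m X (X * Y) p)"
    if P: "P = North # w" and t: "w \<in> tails m (n - 1) 1 0" for P w
  proof -
    let ?V = "valleys_from North (0, 1) w"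
    have fin: "finite ?V" by (rule finite_valleys_from)
    \<comment> \<open>A valley here has height at least \<open>1\<close> and is followed by a north
      step, so its height is also at most \<open>n - 1\<close>; being a return only requires lying
      on the boundary line.\<close>
    have ret: "(\<exists>i\<in>{1..n - 1}. p = (m * i, i)) \<longleftrightarrow> fst p = m * snd p" if p: "p \<in> ?V" for p
    proof -
      have "1 \<le> snd p" using valleys_from_ge[of p North 0 1 w] p by simp
      moreover have "snd p \<le> n - 1"
      proof -
        obtain l where l: "l < length w" "w ! l = North" "snd p = Suc (count_list (take l w) North)"
          using p by (auto simp: valleys_from_eq lattice_point_def)
        have "count_list w North = count_list (take l w @ w ! l # drop (Suc l) w) North"
          using l(1) by (simp add: id_take_nth_drop[symmetric])
        moreover have "count_list w North = n - 1"
          using t assms by (simp add: tails_iff)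
        ultimately show ?thesis using l by simp
      qed
      ultimately show ?thesis
        by (metis atLeastAtMost_iff fst_conv prod.collapse snd_conv)
    qed
    have "X ^ val_count P m = (\<Prod>p\<in>?V. if m dvd fst p then X else 1)"
      using fin by (simp add: val_count_def valleys_eq[OF P] prod.If_cases Int_def)
    moreover have "ret_count m n P = card {p \<in> ?V. fst p = m * snd p}"
      unfolding ret_count_def valleys_eq[OF P] using ret by (intro arg_cong[where f = card]) auto
    then have "Y ^ ret_count m n P = (\<Prod>p\<in>?V. if fst p = m * snd p then Y else 1)"
      using fin by (simp add: prod.If_cases Int_def)
    ultimately show ?thesis
      by (auto simp: valley_weight_def simp flip: prod.distrib intro!: prod.cong)
  qed
  have "dyck_poly m n X Y =
      (\<Sum>w\<in>tails m (n - 1) 1 0. X ^ val_count (North # w) m * Y ^ ret_count m n (North # w))"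
    unfolding dyck_poly_def dyck_paths_eq[OF assms(2)] by (subst sum.reindex) auto
  also have "\<dots> = (\<Sum>w\<in>tails m (n - 1) 1 0. \<Prod>p\<in>valleys_from North (0, 1) w. valley_weight m X (X * Y) p)"
    by (intro sum.cong refl w)
  \<comment> \<open>Row \<open>1\<close> is entered at abscissa \<open>0\<close>, just as a row is
    entered after a return.\<close>
  also have "\<dots> = slot_sum m X (X * Y) (n - 1) (path_slots m X 1 0)"
    by (rule sum_tails_valley_weight) (use assms in auto)
  also have "\<dots> = slot_sum m X (X * Y) (n - 1) (replicate m 1)"
    using mset_path_slots_return[of m X 0] assms by (intro slot_sum_cong_mset) simp
  finally show ?thesis .
qed

section \<open>Canonical configurations\<close>

text \<open>
  A configuration is the decreasing list of coordinates of a dominant point, without the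
  normalisation to coordinate sum \<open>0\<close>; \<open>configs\<close> contains one configuration per flat.
\<close>

definition generic :: "nat \<Rightarrow> real list \<Rightarrow> bool" where
  "generic m xs \<longleftrightarrow> sorted_wrt (>) xs \<and>
     (\<forall>y\<in>set xs. \<forall>z\<in>set xs. \<forall>k\<in>{1..<m}. y - z \<noteq> real k)"

text \<open>These are the values at which the sign pattern of a new largest coordinate can change.
  Allowing \<open>k = 0\<close> makes \<open>hd xs\<close> the lowest mark, the left end of the
  first gap.\<close>

definition marks :: "nat \<Rightarrow> real list \<Rightarrow> real set" where
  "marks m xs = {q \<in> (\<lambda>(y, k). y + real k) ` (set xs \<times> {0..m}). hd xs \<le> q}"

definition tie_marks :: "nat \<Rightarrow> real list \<Rightarrow> real set" where
  "tie_marks m xs = {q \<in> (\<lambda>y. y + real m) ` set xs. hd xs < q}"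

text \<open>A fixed representative of the gap following \<open>p\<close>; the value
  \<open>p + 1\<close> serves for the unbounded gap.\<close>

definition after :: "real set \<Rightarrow> real \<Rightarrow> real" where
  "after A p = (if \<exists>q\<in>A. p < q then (p + Min {q \<in> A. p < q}) / 2 else p + 1)"

definition next_points :: "nat \<Rightarrow> real list \<Rightarrow> real set" where
  "next_points m xs = after (marks m xs) ` marks m xs \<union> tie_marks m xs"

fun configs :: "nat \<Rightarrow> nat \<Rightarrow> real list set" where
  "configs m 0 = {[0]}"
| "configs m (Suc N) = (\<Union>xs\<in>configs m N. (\<lambda>x. x # xs) ` next_points m xs)"

text \<open>The factor \<open>t\<close> records the lost dimension of a tie. The factor
  \<open>u\<close> records that the two largest coordinates differ by more than \<open>m\<close>,
  which will mean a simple separating wall of the flat.\<close>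

definition step_weight :: "nat \<Rightarrow> 'a::comm_semiring_1 \<Rightarrow> 'a \<Rightarrow> real list \<Rightarrow> real \<Rightarrow> 'a" where
  "step_weight m t u xs x =
     (if x - real m \<in> set xs then t else 1) * (if hd xs + real m < x then u else 1)"

fun config_weight :: "nat \<Rightarrow> 'a::comm_semiring_1 \<Rightarrow> 'a \<Rightarrow> real list \<Rightarrow> 'a" where
  "config_weight m t u (x # y # xs) = step_weight m t u (y # xs) x * config_weight m t u (y # xs)"
| "config_weight m t u xs = 1"

text \<open>A mark stands for the gap above it and, if it is a tie mark, also for the position on
  it; the two together have weight \<open>s = 1 + t\<close>. The top mark is the last choice, of
  weight \<open>t + u\<close>, and is left out.\<close>

definition config_slots :: "nat \<Rightarrow> 'a::comm_semiring_1 \<Rightarrow> real list \<Rightarrow> 'a list" where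
  "config_slots m s xs = map (\<lambda>q. if q \<in> tie_marks m xs then s else 1)
     (sorted_list_of_set (marks m xs - {hd xs + real m}))"

section \<open>Positions available to a new largest coordinate\<close>

lemma finite_marks: "finite (marks m xs)"
  and finite_tie_marks: "finite (tie_marks m xs)"
  by (auto simp: marks_def tie_marks_def)

lemma finite_next_points: "finite (next_points m xs)"
  by (simp add: next_points_def finite_marks finite_tie_marks)

lemma finite_configs: "finite (configs m N)"
  by (induction N) (auto simp: finite_next_points)

lemma tie_marks_subset_marks: "tie_marks m xs \<subseteq> marks m xs"
  by (force simp: tie_marks_def marks_def)

lemma less_after: assumes "finite A" shows "p < after A p"
proof -
  have "p < Min {q \<in> A. p < q}" if "\<exists>q\<in>A. p < q"
    using that assms by (subst Min_gr_iff) auto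
  then show ?thesis by (simp add: after_def)
qed

lemma after_less:
  assumes "finite A" "q \<in> A" "p < q"
  shows "after A p < q"
proof -
  have ex: "\<exists>q\<in>A. p < q" using assms by blast
  define b where "b = Min {q \<in> A. p < q}"
  have "b \<le> q"
    unfolding b_def using assms by (intro Min_le) auto
  then show ?thesis unfolding after_def if_P[OF ex] b_def[symmetric] using assms(3) by simp
qed

lemma after_notin: "finite A \<Longrightarrow> after A p \<notin> A"
  using less_after after_less by fastforce

lemma after_less_iff:
  assumes "finite A" "q \<in> A"
  shows "after A p < q \<longleftrightarrow> p < q"
  using assms after_less less_after[of A p] by fastforce

lemma inj_on_after: "finite A \<Longrightarrow> inj_on (after A) A"
  by (rule inj_onI) (metis after_less less_after less_asym linorder_less_linear)

lemma marks_ge: "q \<in> marks m xs \<Longrightarrow> hd xs \<le> q"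
  by (auto simp: marks_def)

lemma generic_le_hd: "generic m xs \<Longrightarrow> y \<in> set xs \<Longrightarrow> y \<le> hd xs"
  by (cases xs) (auto simp: generic_def)

lemma marks_le:
  assumes "generic m xs" "q \<in> marks m xs"
  shows "q \<le> hd xs + real m"
proof -
  obtain y k where "y \<in> set xs" "k \<le> m" "q = y + real k"
    using assms(2) by (auto simp: marks_def)
  then show ?thesis using generic_le_hd[OF assms(1)] by (simp add: add_mono)
qed

lemma hd_plus_in_tie_marks: "m > 0 \<Longrightarrow> xs \<noteq> [] \<Longrightarrow> hd xs + real m \<in> tie_marks m xs"
  by (auto simp: tie_marks_def)

lemma next_points_gt:
  assumes "x \<in> next_points m xs" shows "hd xs < x"
proof -
  have "hd xs < after (marks m xs) p" if "p \<in> marks m xs" for p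
    using marks_ge[OF that] less_after[OF finite_marks] by (rule le_less_trans)
  then show ?thesis using assms by (auto simp: next_points_def tie_marks_def)
qed

text \<open>A forbidden difference \<open>x - y = k\<close> would make \<open>x\<close> a mark,
  which a gap representative is not. If \<open>x = z + m\<close> is a tie, it would give the
  forbidden difference \<open>y - z = m - k\<close> inside \<open>xs\<close>.\<close>

lemma generic_Cons:
  assumes "generic m xs" "x \<in> next_points m xs"
  shows "generic m (x # xs)"
proof -
  have x: "hd xs < x" using assms(2) by (rule next_points_gt)
  have "x - y \<noteq> real k" if "y \<in> set xs" "k \<in> {1..<m}" for y k
  proof
    assume xy: "x - y = real k"
    show False
    proof (cases "x \<in> tie_marks m xs")
      case True
      then obtain z where "z \<in> set xs" "x = z + real m"
        by (auto simp: tie_marks_def)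
      then have "y - z = real (m - k)" "m - k \<in> {1..<m}"
        using xy that by (auto simp: of_nat_diff)
      then show False
        using assms(1) that \<open>z \<in> set xs\<close> unfolding generic_def by blast
    next
      case False
      then have "x \<notin> marks m xs"
        using assms(2) after_notin[OF finite_marks] by (auto simp: next_points_def)
      moreover have "x \<in> marks m xs"
        using xy that x by (auto simp: marks_def image_iff intro!: bexI[of _ y] bexI[of _ k])
      ultimately show False by blast
    qed
  qed
  moreover have "y - x \<noteq> real k" if "y \<in> set xs" for y k
    using generic_le_hd[OF assms(1) that] x by linarith
  ultimately show ?thesis
    using assms(1) x generic_le_hd[OF assms(1)] by (fastforce simp: generic_def)
qed

lemma configs_generic: "xs \<in> configs m N \<Longrightarrow> generic m xs \<and> length xs = Suc N"
proof (induction N arbitrary: xs)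
  case 0
  then show ?case by (auto simp: generic_def)
next
  case (Suc N)
  then show ?case using generic_Cons by force
qed

text \<open>Old marks above \<open>x\<close> survive with their weights, including the old top mark
  if it is among them. The new marks \<open>x + k\<close> with \<open>k < m\<close> are not ties,
  and \<open>x + m\<close> becomes the top mark.\<close>

lemma mset_config_slots_Cons:
  assumes "m > 0" "generic m (x # xs)" "xs \<noteq> []"
  shows "mset (config_slots m s (x # xs)) =
    image_mset (\<lambda>q. if q \<in> tie_marks m xs then s else 1) (mset_set {q \<in> marks m xs. x < q}) +
    replicate_mset m 1"
proof -
  let ?N = "(\<lambda>k. x + real k) ` {0..<m}"
  have x: "y < x" if "y \<in> set xs" for y
    using assms(2) that by (auto simp: generic_def)
  have hd: "hd xs < x" using x assms(3) by simp
  \<comment> \<open>A coincidence would produce the forbidden difference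
    \<open>x - y = l - k\<close>.\<close>
  have apart: "x + real k \<noteq> y + real l" if "y \<in> set xs" "l \<le> m" "x < y + real l" for y k l
  proof
    assume eq: "x + real k = y + real l"
    have "k < l" using eq x[OF that(1)] by linarith
    have "k \<noteq> 0" using eq that by auto
    then have "x - y = real (l - k)" "l - k \<in> {1..<m}"
      using eq \<open>k < l\<close> that by (auto simp: of_nat_diff)
    then show False using assms(2) that(1) by (auto simp: generic_def)
  qed
  have marks: "marks m (x # xs) = (\<lambda>k. x + real k) ` {0..m} \<union> {q \<in> marks m xs. x < q}"
  proof -
    have "x \<in> (\<lambda>k. x + real k) ` {0..m}" by force
    then show ?thesis using hd by (auto simp: marks_def image_iff le_less)
  qed
  have x_m: "x + real m \<notin> {q \<in> marks m xs. x < q}"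
  proof
    assume "x + real m \<in> {q \<in> marks m xs. x < q}"
    then obtain y l where "y \<in> set xs" "l \<le> m" "x + real m = y + real l" "x < x + real m"
      by (auto simp: marks_def)
    then show False using apart[of y l m] by simp
  qed
  have "(\<lambda>k. x + real k) ` {0..m} = insert (x + real m) ?N"
    using assms(1) by (auto simp: image_iff le_less)
  then have eq: "marks m (x # xs) - {hd (x # xs) + real m} = {q \<in> marks m xs. x < q} \<union> ?N"
    using x_m unfolding marks by auto
  have disj: "{q \<in> marks m xs. x < q} \<inter> ?N = {}"
    using apart by (fastforce simp: marks_def)
  have tie_new: "q \<in> tie_marks m (x # xs) \<longleftrightarrow> q \<in> tie_marks m xs"
    if "q \<in> marks m xs" "x < q" for q
    using that hd x_m by (auto simp: tie_marks_def)
  have tie_old: "q \<notin> tie_marks m (x # xs)" if "q \<in> ?N" for q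
    using that apart by (fastforce simp: tie_marks_def)
  have "mset (config_slots m s (x # xs)) =
      image_mset (\<lambda>q. if q \<in> tie_marks m (x # xs) then s else 1) (mset_set {q \<in> marks m xs. x < q}) +
      image_mset (\<lambda>q. if q \<in> tie_marks m (x # xs) then s else 1) (mset_set ?N)"
    unfolding config_slots_def eq mset_map_sorted_list_of_set
    using disj by (subst mset_set_Union) (auto simp: finite_marks)
  also have "image_mset (\<lambda>q. if q \<in> tie_marks m (x # xs) then s else 1) (mset_set {q \<in> marks m xs. x < q}) =
      image_mset (\<lambda>q. if q \<in> tie_marks m xs then s else 1) (mset_set {q \<in> marks m xs. x < q})"
    by (rule image_mset_cong) (use tie_new finite_marks in auto)
  also have "image_mset (\<lambda>q. if q \<in> tie_marks m (x # xs) then s else 1) (mset_set ?N) =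
      image_mset (\<lambda>q. 1) (mset_set ?N)"
    by (rule image_mset_cong) (use tie_old in auto)
  also have "\<dots> = replicate_mset m 1"
    by (simp add: image_mset_const_eq card_image inj_on_def)
  finally show ?thesis .
qed

text \<open>The gap above \<open>p\<close> and the tie on \<open>p\<close> leave the same marks
  beyond them, hence share the continuation \<open>h p\<close>. Their weights add up to
  \<open>1 + t\<close> at an ordinary tie mark, to \<open>1\<close> at a mark without tie and to
  \<open>t + u\<close> at the top mark.\<close>

lemma sum_next_points:
  assumes m: "m > 0" and xs: "generic m xs" "xs \<noteq> []"
  shows "(\<Sum>x\<in>next_points m xs. step_weight m t u xs x *
      slot_sum m (1 + t) (t + u) r (config_slots m (1 + t) (x # xs))) =
    slot_sum m (1 + t) (t + u) (Suc r) (config_slots m (1 + t) xs)"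
proof -
  let ?A = "marks m xs" and ?T = "tie_marks m xs" and ?M = "hd xs + real m"
  let ?f = "\<lambda>q. if q \<in> ?T then 1 + t else 1"
  let ?S = "slot_sum m (1 + t) (t + u) r"
  define h where "h p = ?S (map ?f (sorted_list_of_set {q \<in> ?A. p < q}) @ replicate m 1)" for p
  have slots: "?S (config_slots m (1 + t) (x # xs)) = h p"
    if "x \<in> next_points m xs" "{q \<in> ?A. x < q} = {q \<in> ?A. p < q}" for x p
    unfolding h_def that(2)[symmetric]
    by (rule slot_sum_cong_mset, subst mset_config_slots_Cons[OF m generic_Cons[OF xs(1) that(1)] xs(2)])
      (simp only: mset_append mset_map_sorted_list_of_set mset_replicate)
  have fin: "finite ?A" by (rule finite_marks)
  have MT: "?M \<in> ?T" using m xs(2) by (rule hd_plus_in_tie_marks)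
  then have MA: "?M \<in> ?A" using tie_marks_subset_marks by blast
  have gap: "step_weight m t u xs (after ?A p) * ?S (config_slots m (1 + t) (after ?A p # xs)) =
      (if p = ?M then u else 1) * h p" if p: "p \<in> ?A" for p
  proof -
    have "after ?A p \<in> next_points m xs" using p by (auto simp: next_points_def)
    note * = this next_points_gt[OF this]
    have "after ?A p \<notin> ?T"
      using after_notin[OF fin] tie_marks_subset_marks by blast
    then have "after ?A p - real m \<notin> set xs"
      using *(2) by (auto simp: tie_marks_def image_iff)
    moreover have "?M < after ?A p \<longleftrightarrow> p = ?M"
      using after_less_iff[OF fin MA, of p] marks_le[OF xs(1) p] less_after[OF fin, of p]
        after_notin[OF fin, of p] MA by (metis linorder_less_linear order_less_le less_asym)
    moreover have "{q \<in> ?A. after ?A p < q} = {q \<in> ?A. p < q}"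
      using after_less_iff[OF fin] by blast
    note slots[OF *(1) this]
    ultimately show ?thesis
      by (simp add: step_weight_def)
  qed
  have tie: "step_weight m t u xs p * ?S (config_slots m (1 + t) (p # xs)) = t * h p"
    if p: "p \<in> ?T" for p
  proof -
    have "p - real m \<in> set xs" using p by (auto simp: tie_marks_def)
    moreover have "\<not> ?M < p"
      using marks_le[OF xs(1)] p tie_marks_subset_marks by fastforce
    ultimately show ?thesis
      using slots[of p p] p by (simp add: step_weight_def next_points_def)
  qed
  have disj: "after ?A ` ?A \<inter> ?T = {}"
    using after_notin[OF fin] tie_marks_subset_marks by blast
  have T: "?T = ?A \<inter> ?T" using tie_marks_subset_marks by blast
  have "(\<Sum>x\<in>next_points m xs. step_weight m t u xs x * ?S (config_slots m (1 + t) (x # xs))) =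
      (\<Sum>p\<in>?A. (if p = ?M then u else 1) * h p) + (\<Sum>p\<in>?T. t * h p)"
    unfolding next_points_def
    by (subst sum.union_disjoint)
      (use fin disj in \<open>simp_all add: finite_tie_marks sum.reindex inj_on_after gap tie cong: sum.cong\<close>)
  also have "(\<Sum>p\<in>?T. t * h p) = (\<Sum>p\<in>?A. if p \<in> ?T then t * h p else 0)"
    by (subst T, subst sum.inter_restrict[OF fin]) (rule refl)
  also have "(\<Sum>p\<in>?A. (if p = ?M then u else 1) * h p) + \<dots> =
      (\<Sum>p\<in>?A. (if p = ?M then u else 1) * h p + (if p \<in> ?T then t * h p else 0))"
    by (rule sum.distrib[symmetric])
  also have "\<dots> = (u * h ?M + t * h ?M) + (\<Sum>p\<in>?A - {?M}. ?f p * h p)"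
    by (subst sum.remove[OF fin MA], rule arg_cong2[where f = "(+)"], simp add: MT)
      (rule sum.cong, simp_all add: distrib_right split: if_split)
  also have "h ?M = ?S (replicate m 1)"
  proof -
    have "{q \<in> ?A. ?M < q} = {}" using marks_le[OF xs(1)] by fastforce
    then show ?thesis unfolding h_def by (simp only:) simp
  qed
  also have "(\<Sum>p\<in>?A - {?M}. ?f p * h p) = (\<Sum>p\<in>?A - {?M}. ?f p *
      ?S (map ?f (sorted_list_of_set {q \<in> ?A - {?M}. p < q}) @ (1 + t) # replicate m 1))"
  proof (intro sum.cong refl arg_cong2[where f = "(*)"])
    \<comment> \<open>The old top mark stays above \<open>p\<close>; being a tie mark, it supplies
      the new entry \<open>1 + t\<close>.\<close>
    fix p assume p: "p \<in> ?A - {?M}"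
    then have "p < ?M" using marks_le[OF xs(1), of p] by auto
    then have "{q \<in> ?A. p < q} = insert ?M {q \<in> ?A - {?M}. p < q}"
      using MA by auto
    then have "mset_set {q \<in> ?A. p < q} = add_mset ?M (mset_set {q \<in> ?A - {?M}. p < q})"
      using fin by simp
    then show "h p = ?S (map ?f (sorted_list_of_set {q \<in> ?A - {?M}. p < q}) @ (1 + t) # replicate m 1)"
      unfolding h_def
      by (intro slot_sum_cong_mset, simp only: mset_map_sorted_list_of_set mset_append mset.simps)
        (simp add: MT)
  qed
  finally show ?thesis
    unfolding config_slots_def using fin by (simp add: slot_sum_Suc_sorted algebra_simps)
qed

text \<open>Induction on the number \<open>r\<close> of insertions still to come, with the layer
  \<open>N\<close> generalised: each layer is absorbed by one step of
  \<open>slot_sum\<close>.\<close>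

lemma sum_config_weight:
  assumes m: "m > 0"
  shows "(\<Sum>xs\<in>configs m (N + r). config_weight m t u xs) =
    (\<Sum>xs\<in>configs m N. config_weight m t u xs * slot_sum m (1 + t) (t + u) r (config_slots m (1 + t) xs))"
proof (induction r arbitrary: N)
  case (Suc r)
  let ?S = "\<lambda>r xs. slot_sum m (1 + t) (t + u) r (config_slots m (1 + t) xs)"
  have ne: "xs \<noteq> []" "generic m xs" if "xs \<in> configs m N" for xs
    using configs_generic[OF that] by auto
  have cw: "config_weight m t u (x # xs) = step_weight m t u xs x * config_weight m t u xs"
    if "xs \<noteq> []" for x xs
    using that by (cases xs) auto
  have "(\<Sum>xs\<in>configs m (N + Suc r). config_weight m t u xs) =
      (\<Sum>xs\<in>configs m (Suc N). config_weight m t u xs * ?S r xs)"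
    using Suc.IH[of "Suc N"] by simp
  also have "\<dots> = (\<Sum>xs\<in>configs m N. \<Sum>xs\<in>(\<lambda>x. x # xs) ` next_points m xs. config_weight m t u xs * ?S r xs)"
    unfolding configs.simps
    by (rule sum.UNION_disjoint) (auto simp: finite_configs finite_next_points)
  also have "\<dots> = (\<Sum>xs\<in>configs m N. config_weight m t u xs * ?S (Suc r) xs)"
  proof (rule sum.cong[OF refl])
    fix xs assume xs: "xs \<in> configs m N"
    have "(\<Sum>xs\<in>(\<lambda>x. x # xs) ` next_points m xs. config_weight m t u xs * ?S r xs) =
       config_weight m t u xs * (\<Sum>x\<in>next_points m xs. step_weight m t u xs x * ?S r (x # xs))"
      by (subst sum.reindex) (auto simp: inj_on_def cw[OF ne(1)[OF xs]] sum_distrib_left algebra_simps intro!: sum.cong)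
    then show "(\<Sum>xs\<in>(\<lambda>x. x # xs) ` next_points m xs. config_weight m t u xs * ?S r xs) =
       config_weight m t u xs * ?S (Suc r) xs"
      by (simp only: sum_next_points[OF m ne(2,1)[OF xs]])
  qed
  finally show ?case .
qed simp

lemma sum_configs_eq_slot_sum:
  assumes m: "m > 0"
  shows "(\<Sum>xs\<in>configs m N. config_weight m t u xs) = slot_sum m (1 + t) (t + u) N (replicate m 1)"
proof -
  \<comment> \<open>The start \<open>[0]\<close> has the marks \<open>0, ..., m\<close>; below the
    top one there are \<open>m\<close> slots, none of them a tie.\<close>
  have marks: "marks m [0] - {real m} = real ` {0..<m}"
    using m by (auto simp: marks_def image_iff le_less)
  have "mset (config_slots m (1 + t) [0]) = image_mset (\<lambda>q. 1) (mset_set (real ` {0..<m}))"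
    unfolding config_slots_def list.sel add_0 marks mset_map_sorted_list_of_set
    by (rule image_mset_cong) (auto simp: tie_marks_def)
  also have "\<dots> = mset (replicate m 1)"
    by (simp add: image_mset_const_eq card_image inj_on_def)
  finally have "slot_sum m (1 + t) (t + u) N (config_slots m (1 + t) [0]) =
      slot_sum m (1 + t) (t + u) N (replicate m 1)"
    by (rule slot_sum_cong_mset)
  then show ?thesis
    using sum_config_weight[OF m, of t u 0 N] by simp
qed

section \<open>Configurations up to signs\<close>

definition same_signs :: "nat \<Rightarrow> real list \<Rightarrow> real list \<Rightarrow> bool" where
  "same_signs m xs ys \<longleftrightarrow> length xs = length ys \<and>
     (\<forall>i j k. i < j \<longrightarrow> j < length xs \<longrightarrow> k \<in> {1..m} \<longrightarrow>
        sgn (xs ! i - xs ! j - real k) = sgn (ys ! i - ys ! j - real k))"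

lemma same_signs_Cons:
  "same_signs m (x # xs) (y # ys) \<longleftrightarrow> same_signs m xs ys \<and>
     (\<forall>j<length xs. \<forall>k\<in>{1..m}. sgn (x - xs ! j - real k) = sgn (y - ys ! j - real k))"
proof -
  have "(\<forall>i j. i < j \<longrightarrow> j < length (x # xs) \<longrightarrow> Q i j) \<longleftrightarrow>
      (\<forall>j<length xs. Q 0 (Suc j)) \<and> (\<forall>i j. i < j \<longrightarrow> j < length xs \<longrightarrow> Q (Suc i) (Suc j))"
    for Q :: "nat \<Rightarrow> nat \<Rightarrow> bool"
    by (auto simp: less_Suc_eq_0_disj)
  note split = this
  have "same_signs m (x # xs) (y # ys) \<longleftrightarrow> length xs = length ys \<and>
     (\<forall>i j. i < j \<longrightarrow> j < length (x # xs) \<longrightarrow> (\<forall>k\<in>{1..m}.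
        sgn ((x # xs) ! i - (x # xs) ! j - real k) = sgn ((y # ys) ! i - (y # ys) ! j - real k)))"
    by (auto simp: same_signs_def)
  also have "\<dots> \<longleftrightarrow> same_signs m xs ys \<and>
     (\<forall>j<length xs. \<forall>k\<in>{1..m}. sgn (x - xs ! j - real k) = sgn (y - ys ! j - real k))"
    unfolding split by (auto simp: same_signs_def)
  finally show ?thesis .
qed

lemma generic_nth_less: "generic m xs \<Longrightarrow> i < j \<Longrightarrow> j < length xs \<Longrightarrow> xs ! j < xs ! i"
  by (auto simp: generic_def dest: sorted_wrt_nth_less)

lemma generic_distinct:
  assumes "generic m xs" shows "distinct xs"
  unfolding distinct_conv_nth
  using generic_nth_less[OF assms] by (metis less_irrefl linorder_less_linear)

lemma same_signsD:
  "same_signs m xs ys \<Longrightarrow> i < j \<Longrightarrow> j < length xs \<Longrightarrow> 0 < k \<Longrightarrow> k \<le> m \<Longrightarrow>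
    sgn (xs ! i - xs ! j - real k) = sgn (ys ! i - ys ! j - real k)"
  by (simp add: same_signs_def)

text \<open>The sign pattern fixes the order of all shifted values, hence of the marks. For
  \<open>i < j\<close> the comparison is a recorded sign at level \<open>l - k\<close> if
  \<open>k < l\<close>, and otherwise follows because the lists decrease.\<close>

lemma same_signs_shifted:
  assumes "same_signs m xs ys" "generic m xs" "generic m ys"
    and "i < length xs" "j < length xs" "k \<le> m" "l \<le> m"
  shows "sgn ((xs ! i + real k) - (xs ! j + real l)) = sgn ((ys ! i + real k) - (ys ! j + real l))"
proof -
  have less: "sgn ((xs ! i + real k) - (xs ! j + real l)) = sgn ((ys ! i + real k) - (ys ! j + real l))"
    if "i < j" "j < length xs" "k \<le> m" "l \<le> m" for i j k l
  proof (cases "k < l")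
    case True
    then have "sgn (xs ! i - xs ! j - real (l - k)) = sgn (ys ! i - ys ! j - real (l - k))"
      by (intro same_signsD[OF assms(1)]) (use that True in auto)
    then show ?thesis using True by (simp add: of_nat_diff algebra_simps)
  next
    case False
    have "xs ! j < xs ! i" "ys ! j < ys ! i"
      using generic_nth_less assms that by (auto simp: same_signs_def)
    with False show ?thesis by simp
  qed
  consider "i < j" | "i = j" | "j < i" by linarith
  then show ?thesis
  proof cases
    case 3
    then have "sgn (- ((xs ! i + real k) - (xs ! j + real l))) =
        sgn (- ((ys ! i + real k) - (ys ! j + real l)))"
      using less[of j i l k] assms by simp
    then show ?thesis by (simp only: sgn_minus neg_equal_iff_equal)
  qed (use less assms in auto)
qed

section \<open>Exactly one configuration for each sign pattern\<close>

lemma sgn_eq_iff: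
  fixes a b c d :: real
  assumes "sgn (a - b) = sgn (c - d)"
  shows "a < b \<longleftrightarrow> c < d" "a \<le> b \<longleftrightarrow> c \<le> d"
  using assms by (auto simp: sgn_if split: if_splits)

lemma finite_has_max_image:
  fixes f :: "'b \<Rightarrow> 'c::linorder"
  assumes "finite S" "a \<in> S"
  obtains q where "q \<in> S" "\<And>r. r \<in> S \<Longrightarrow> f r \<le> f q"
proof -
  have "Max (f ` S) \<in> f ` S" using assms by (intro Max_in) auto
  then obtain q where "q \<in> S" "Max (f ` S) = f q" by blast
  then show ?thesis using that[of q] assms(1) by (metis Max_ge finite_imageI imageI)
qed

text \<open>Replace all but the largest coordinate by a canonical configuration. Its marks are
  ordered like the shifted values of the original, so the largest coordinate can be put on the
  corresponding tie or into the corresponding gap.\<close>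

lemma configs_exhaust_signs:
  assumes "m > 0" "generic m ys" "length ys = Suc N"
  shows "\<exists>xs\<in>configs m N. same_signs m xs ys"
  using assms(2,3)
proof (induction N arbitrary: ys)
  case 0
  then obtain y where "ys = [y]" by (auto simp: length_Suc_conv)
  then show ?case by (simp add: same_signs_def)
next
  case (Suc N)
  then obtain y zs where ys: "ys = y # zs" "length zs = Suc N"
    by (auto simp: length_Suc_conv)
  have zs: "generic m zs" using Suc.prems(1) by (simp add: ys generic_def)
  obtain xs where xs: "xs \<in> configs m N" "same_signs m xs zs"
    using Suc.IH[OF zs ys(2)] by blast
  have gx: "generic m xs" and len: "length xs = Suc N" using configs_generic[OF xs(1)] by auto
  note shifted = same_signs_shifted[OF xs(2) gx zs]
  have nth_y: "zs ! j < y" if "j < length zs" for j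
    using Suc.prems(1) that by (auto simp: ys generic_def)
  have hd: "hd xs = xs ! 0" "hd zs = zs ! 0" using len ys(2) by (cases xs; cases zs; simp)+
  have in_marks: "xs ! j + real k \<in> marks m xs"
    if "hd xs \<le> xs ! j + real k" "j < length xs" "k \<le> m" for j k
    using that by (auto simp: marks_def image_iff intro!: bexI[of _ "xs ! j"] bexI[of _ k])
  have "\<exists>x\<in>next_points m xs. \<forall>j<length xs. \<forall>k\<in>{1..m}.
      sgn (x - xs ! j - real k) = sgn (y - zs ! j - real k)"
  proof (cases "\<exists>j<length xs. y = zs ! j + real m")
    case True
    then obtain j where j: "j < length xs" "y = zs ! j + real m" by blast
    have "hd xs < xs ! j + real m"
      using sgn_eq_iff(1)[OF shifted[of 0 j 0 m]] j len ys nth_y[of 0] by (simp add: hd)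
    then have "xs ! j + real m \<in> next_points m xs"
      using j by (auto simp: next_points_def tie_marks_def)
    moreover have "sgn (xs ! j + real m - xs ! l - real k) = sgn (y - zs ! l - real k)"
      if "l < length xs" "k \<in> {1..m}" for l k
      using shifted[of j l m k] that j by (simp add: algebra_simps)
    ultimately show ?thesis by blast
  next
    case False
    \<comment> \<open>The largest shifted value below \<open>y\<close> gives the left end of the
      gap. As \<open>(0, 0)\<close> belongs to \<open>S\<close>, this end is at least the current
      maximum and thus corresponds to a mark.\<close>
    define S where "S = {q \<in> {..<length xs} \<times> {0..m}. zs ! fst q + real (snd q) < y}"
    have "finite S" by (simp add: S_def)
    moreover have "(0, 0) \<in> S" using len ys nth_y[of 0] by (auto simp: S_def)
    ultimately obtain q where q: "q \<in> S"
        "\<And>r. r \<in> S \<Longrightarrow> zs ! fst r + real (snd r) \<le> zs ! fst q + real (snd q)"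
      using finite_has_max_image[of S "(0, 0)" "\<lambda>q. zs ! fst q + real (snd q)"] by blast
    obtain j0 k0 where jk: "q = (j0, k0)" by (cases q)
    have j0: "j0 < length xs" "k0 \<le> m" "zs ! j0 + real k0 < y"
      using q(1) by (auto simp: S_def jk)
    let ?p = "xs ! j0 + real k0"
    have "hd xs \<le> ?p"
      using q(2)[OF \<open>(0, 0) \<in> S\<close>] sgn_eq_iff(2)[OF shifted[of 0 j0 0 k0]] j0 len
      by (simp add: hd jk)
    then have p: "?p \<in> marks m xs" using in_marks j0 by blast
    let ?x = "after (marks m xs) ?p"
    have "?x \<in> next_points m xs" using p by (auto simp: next_points_def)
    moreover have "sgn (?x - xs ! l - real k) = sgn (y - zs ! l - real k)"
      if l: "l < length xs" "k \<in> {1..m}" for l k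
    proof (cases "zs ! l + real k < y")
      case True
      then have "(l, k) \<in> S" using l by (auto simp: S_def)
      then have "xs ! l + real k \<le> ?p"
        using q(2)[of "(l, k)"] sgn_eq_iff(2)[OF shifted[of l j0 k k0]] l j0 by (simp add: jk)
      also have "?p < ?x" by (rule less_after[OF finite_marks])
      finally show ?thesis using True by simp
    next
      case notless: False
      \<comment> \<open>The level \<open>k = m\<close> is excluded by the present case, smaller
        levels by genericity.\<close>
      have "y - zs ! l \<noteq> real k"
      proof (cases "k = m")
        case True
        then show ?thesis using False l by auto
      next
        case False
        then show ?thesis using Suc.prems(1) l len ys by (auto simp: generic_def)
      qed
      then have gt: "y < zs ! l + real k" using notless by simp
      then have "?p < xs ! l + real k"
        using sgn_eq_iff(1)[OF shifted[of j0 l k0 k]] j0 l by simp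
      then have "?x < xs ! l + real k"
        using \<open>hd xs \<le> ?p\<close> l by (intro after_less[OF finite_marks] in_marks) auto
      then show ?thesis using gt by simp
    qed
    ultimately show ?thesis by blast
  qed
  then obtain x where "x \<in> next_points m xs" "same_signs m (x # xs) ys"
    unfolding ys same_signs_Cons using xs(2) by blast
  then show ?case using xs(1) by auto
qed

text \<open>Once the smaller coordinates agree, the signs of the new one relative to the marks above
  \<open>hd zs\<close> determine its tie or gap, and each gap has only one representative.\<close>

lemma configs_inj_signs:
  assumes "xs \<in> configs m N" "ys \<in> configs m N" "same_signs m xs ys"
  shows "xs = ys"
  using assms
proof (induction N arbitrary: xs ys)
  case (Suc N)
  obtain x zs where xs: "xs = x # zs" "zs \<in> configs m N" "x \<in> next_points m zs"
    using Suc.prems(1) by auto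
  obtain y zs' where ys: "ys = y # zs'" "zs' \<in> configs m N" "y \<in> next_points m zs'"
    using Suc.prems(2) by auto
  have "zs = zs'"
    using Suc.IH[OF xs(2) ys(2)] Suc.prems(3) by (simp add: xs ys same_signs_Cons)
  note ys = ys[folded this]
  let ?A = "marks m zs"
  have gz: "generic m zs" using configs_generic[OF xs(2)] by blast
  have eq: "sgn (x - q) = sgn (y - q)" if q: "q \<in> ?A" "hd zs < q" for q
  proof -
    obtain z k where zk: "z \<in> set zs" "k \<le> m" "q = z + real k"
      using q by (auto simp: marks_def)
    then have "k \<noteq> 0" using generic_le_hd[OF gz zk(1)] q by auto
    then show ?thesis
      using Suc.prems(3) zk by (auto simp: xs ys same_signs_Cons in_set_conv_nth algebra_simps)
  qed
  \<comment> \<open>The larger mark \<open>q\<close> separates the two representatives, and it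
    exceeds \<open>hd zs\<close> because \<open>p\<close> is already at least
    \<open>hd zs\<close>.\<close>
  have gap: False if "p \<in> ?A" "q \<in> ?A" "x' = after ?A p" "y' = after ?A q" "p < q"
      "\<And>q. q \<in> ?A \<Longrightarrow> hd zs < q \<Longrightarrow> sgn (x' - q) = sgn (y' - q)" for p q x' y'
    using that(6)[OF that(2)] after_less[OF finite_marks that(2,5)]
      less_after[OF finite_marks, of q m zs] marks_ge[OF that(1)] that(3-5)
    by (simp add: sgn_if)
  have "x = y"
  proof (cases "x \<in> tie_marks m zs \<or> y \<in> tie_marks m zs")
    case True
    then show ?thesis
      using eq[of x] eq[of y] tie_marks_subset_marks[of m zs] next_points_gt[OF xs(3)]
        next_points_gt[OF ys(3)] by (auto simp: sgn_zero_iff)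
  next
    case False
    then obtain p q where pq: "p \<in> ?A" "x = after ?A p" "q \<in> ?A" "y = after ?A q"
      using xs(3) ys(3) by (auto simp: next_points_def)
    show ?thesis
      using gap[of p q x y] gap[of q p y x] eq pq by (metis linorder_less_linear)
  qed
  then show ?case by (simp add: xs ys)
qed simp

section \<open>Ties and wide gaps as the exponents of the weight\<close>

definition tie_pairs :: "nat \<Rightarrow> real list \<Rightarrow> (nat \<times> nat) set" where
  "tie_pairs m xs = {(i, j). i < j \<and> j < length xs \<and> xs ! i - xs ! j = real m}"

definition wide_gaps :: "nat \<Rightarrow> real list \<Rightarrow> nat set" where
  "wide_gaps m xs = {i. Suc i < length xs \<and> xs ! i - xs ! Suc i > real m}"

lemma finite_tie_pairs: "finite (tie_pairs m xs)"
  by (rule finite_subset[of _ "{..<length xs} \<times> {..<length xs}"]) (auto simp: tie_pairs_def)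

text \<open>Distinctness makes the partner at distance \<open>m\<close> below \<open>x\<close>
  unique, so the new entry adds at most one tie.\<close>

lemma card_tie_pairs_Cons:
  assumes "distinct xs"
  shows "card (tie_pairs m (x # xs)) = (if x - real m \<in> set xs then 1 else 0) + card (tie_pairs m xs)"
proof -
  let ?J = "{j. j < length xs \<and> xs ! j = x - real m}"
  have "tie_pairs m (x # xs) = (\<lambda>j. (0, Suc j)) ` ?J \<union> (\<lambda>p. (Suc (fst p), Suc (snd p))) ` tie_pairs m xs"
  proof (rule set_eqI)
    fix p show "p \<in> tie_pairs m (x # xs) \<longleftrightarrow>
        p \<in> (\<lambda>j. (0, Suc j)) ` ?J \<union> (\<lambda>p. (Suc (fst p), Suc (snd p))) ` tie_pairs m xs"
      by (cases p; cases "fst p"; cases "snd p") (auto simp: tie_pairs_def image_iff)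
  qed
  then have "card (tie_pairs m (x # xs)) = card ?J + card (tie_pairs m xs)"
    by (simp only:, subst card_Un_disjoint)
      (auto simp: finite_tie_pairs card_image inj_on_def prod_eq_iff)
  moreover have "card ?J = (if x - real m \<in> set xs then 1 else 0)"
  proof (cases "x - real m \<in> set xs")
    case True
    then obtain j where "j < length xs" "xs ! j = x - real m" by (auto simp: in_set_conv_nth)
    then have "?J = {j}" using assms nth_eq_iff_index_eq by fastforce
    then show ?thesis using True by simp
  next
    case False
    then have "?J = {}" by (auto simp: in_set_conv_nth)
    then show ?thesis using False by simp
  qed
  ultimately show ?thesis by simp
qed

lemma card_wide_gaps_Cons:
  assumes "xs \<noteq> []"
  shows "card (wide_gaps m (x # xs)) = (if hd xs + real m < x then 1 else 0) + card (wide_gaps m xs)"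
proof -
  have "wide_gaps m (x # xs) = (if hd xs + real m < x then {0} else {}) \<union> Suc ` wide_gaps m xs"
  proof (rule set_eqI)
    fix i show "i \<in> wide_gaps m (x # xs) \<longleftrightarrow>
        i \<in> (if hd xs + real m < x then {0} else {}) \<union> Suc ` wide_gaps m xs"
      using assms by (cases i) (auto simp: wide_gaps_def hd_conv_nth)
  qed
  moreover have "finite (wide_gaps m xs)"
    by (rule finite_subset[of _ "{..<length xs}"]) (auto simp: wide_gaps_def)
  ultimately show ?thesis by (simp add: card_image)
qed

lemma config_weight_eq:
  assumes "generic m xs"
  shows "config_weight m t u xs = t ^ card (tie_pairs m xs) * u ^ card (wide_gaps m xs)"
  using assms
proof (induction m t u xs rule: config_weight.induct)
  case (1 m t u x y xs)
  then have "generic m (y # xs)" by (auto simp: generic_def)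
  moreover have "distinct (y # xs)"
    by (rule generic_distinct) fact
  ultimately show ?case
    using 1(1) by (simp add: step_weight_def card_tie_pairs_Cons card_wide_gaps_Cons algebra_simps)
next
  case ("2_2" m t u v)
  have "tie_pairs m [v] = {}" by (auto simp: tie_pairs_def)
  then show ?case by (simp add: wide_gaps_def)
qed (simp add: tie_pairs_def wide_gaps_def)

section \<open>Dimensions and walls\<close>

text \<open>A triangular system: vectors are added from the largest index downwards, and each new
  one is the first with a nonzero entry in its own coordinate.\<close>

lemma independent_leading_coordinates:
  fixes f :: "'n \<Rightarrow> real ^ 'n::{finite,linorder}"
  assumes "finite S" "\<And>i. i \<in> S \<Longrightarrow> f i $ i \<noteq> 0" "\<And>i j. i \<in> S \<Longrightarrow> j < i \<Longrightarrow> f i $ j = 0"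
  shows "independent (f ` S) \<and> card (f ` S) = card S"
  using assms
proof (induction S rule: finite_linorder_min_induct)
  case (insert b A)
  have IH: "independent (f ` A) \<and> card (f ` A) = card A"
    using insert.IH insert.prems by blast
  have "f i $ b = 0" if "i \<in> A" for i
    using insert.prems(2)[of i b] insert.hyps(2) that by blast
  then have "span (f ` A) \<subseteq> {v. v $ b = 0}"
    by (intro span_minimal) (auto simp: subspace_def)
  then have "f b \<notin> span (f ` A)"
    using insert.prems(1)[of b] by auto
  moreover from this have "f b \<notin> f ` A"
    by (rule contrapos_nn) (rule span_base)
  moreover have "b \<notin> A" using insert.hyps by auto
  ultimately show ?case
    using IH insert.hyps(1) by (simp add: independent_insert)
qed (simp add: independent_empty)

definition tie_space :: "nat \<Rightarrow> ('n \<times> 'n) set \<Rightarrow> (real ^ 'n) set" where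
  "tie_space m T = {x \<in> sum_zero. \<forall>(i, j)\<in>T. x $ i - x $ j = real m}"

lemma convex_tie_space:
  fixes T :: "('n::finite \<times> 'n) set"
  shows "convex (tie_space m T)"
proof -
  have "sum_zero = {x::real ^ 'n. (\<chi> i. 1) \<bullet> x = 0}"
    by (simp add: sum_zero_def inner_vec_def)
  moreover have "x $ i - x $ j = (axis i 1 - axis j 1) \<bullet> x" for x :: "real ^ 'n" and i j
    by (simp add: inner_diff_left inner_axis')
  ultimately have "tie_space m T = {x::real ^ 'n. (\<chi> i. 1) \<bullet> x = 0} \<inter>
      (\<Inter>(i, j)\<in>T. {x. (axis i 1 - axis j 1) \<bullet> x = real m})"
    unfolding tie_space_def by auto
  then show ?thesis
    by (auto intro!: convex_Int convex_INT convex_hyperplane)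
qed

text \<open>The tie space is a translate of the orthogonal complement of \<open>B\<close>, which
  consists of the normals of the ties and the all-ones vector. The normals have distinct leading
  coordinates, and the all-ones vector is orthogonal to them, so \<open>B\<close> is
  independent.\<close>

lemma aff_dim_tie_space:
  fixes T :: "('n::{finite,linorder} \<times> 'n) set"
  assumes "\<And>i j. (i, j) \<in> T \<Longrightarrow> i < j" "inj_on fst T" "tie_space m T \<noteq> {}"
  shows "aff_dim (tie_space m T) = int CARD('n) - 1 - int (card T)"
proof -
  obtain x0 where x0: "x0 \<in> tie_space m T" using assms(3) by blast
  \<comment> \<open>By injectivity of \<open>fst\<close> on \<open>T\<close>, this is the only
    partner of \<open>i\<close>.\<close>
  define p where "p = (\<lambda>i. SOME j. (i, j) \<in> T)"
  have p: "(i, p i) \<in> T" if "i \<in> fst ` T" for i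
    using that unfolding p_def by (metis imageE prod.collapse someI)
  have p_eq: "j = p i" if "(i, j) \<in> T" for i j
    using inj_onD[OF assms(2) _ that p] that by force
  let ?f = "\<lambda>i. axis i 1 - axis (p i) 1 :: real ^ 'n::{finite,linorder}" and ?one = "(\<chi> i. 1) :: real ^ 'n::{finite,linorder}"
  define B where "B = insert ?one (?f ` fst ` T)"
  have lt: "i < p i" if "i \<in> fst ` T" for i
    using assms(1) p that by blast
  have f_nth: "?f i $ c = (if c = i then 1 else 0) - (if c = p i then 1 else 0)" for i c
    by (simp add: axis_def)
  have f: "independent (?f ` fst ` T) \<and> card (?f ` fst ` T) = card (fst ` T)"
  proof (rule independent_leading_coordinates)
    show "?f i $ i \<noteq> 0" if "i \<in> fst ` T" for i
      using lt[OF that] unfolding f_nth by auto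
    show "?f i $ c = 0" if "i \<in> fst ` T" "c < i" for i c
      using lt[OF that(1)] that(2) unfolding f_nth by auto
  qed simp
  have "span (?f ` fst ` T) \<subseteq> {x. ?one \<bullet> x = 0}"
    by (rule span_minimal) (auto simp: subspace_hyperplane inner_diff_right inner_axis)
  moreover have "?one \<bullet> ?one \<noteq> 0" by (simp add: inner_vec_def)
  ultimately have one: "?one \<notin> span (?f ` fst ` T)" by blast
  then have "?one \<notin> ?f ` fst ` T"
    by (rule contrapos_nn) (rule span_base)
  moreover have "card (?f ` fst ` T) = card T"
    using f card_image[OF assms(2)] by simp
  moreover have "finite (?f ` fst ` T)" by simp
  ultimately have "card B = Suc (card T)"
    unfolding B_def by (metis card_insert_disjoint)
  moreover have "independent B"
    unfolding B_def by (rule independent_insertI[OF one conjunct1[OF f]])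
  ultimately have indep: "independent B" "card B = Suc (card T)" by blast+
  let ?V = "{y. \<forall>x\<in>span B. orthogonal x y}"
  have "dim ?V + dim (span B) = CARD('n)"
    using dim_subspace_orthogonal_to_vectors[of "span B" UNIV] by simp
  then have dim: "int (dim ?V) = int CARD('n) - 1 - int (card T)"
    using indep by (simp add: dim_eq_card)
  have V: "y \<in> ?V \<longleftrightarrow> y \<in> sum_zero \<and> (\<forall>(i, j)\<in>T. y $ i - y $ j = 0)" for y
  proof -
    have "y \<in> ?V \<longleftrightarrow> (\<forall>x\<in>B. orthogonal x y)"
    proof
      assume "\<forall>x\<in>B. orthogonal x y"
      then have "span B \<subseteq> {x. orthogonal x y}"
        by (intro span_minimal) (auto simp: subspace_def orthogonal_clauses)
      then show "y \<in> ?V" by blast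
    qed (auto intro: span_base)
    also have "\<dots> \<longleftrightarrow> y \<in> sum_zero \<and> (\<forall>i\<in>fst ` T. y $ i - y $ p i = 0)"
      by (simp add: B_def orthogonal_def inner_diff_left inner_axis' sum_zero_def) (simp add: inner_vec_def)
    also have "\<dots> \<longleftrightarrow> y \<in> sum_zero \<and> (\<forall>(i, j)\<in>T. y $ i - y $ j = 0)"
      using p p_eq by fastforce
    finally show ?thesis .
  qed
  have "subspace ?V" by (rule subspace_orthogonal_to_vectors)
  have "tie_space m T = (+) x0 ` ?V"
  proof -
    have "x \<in> tie_space m T \<longleftrightarrow> x - x0 \<in> ?V" for x
    proof -
      have "x $ i - x $ j = real m \<longleftrightarrow> (x - x0) $ i - (x - x0) $ j = 0" if "(i, j) \<in> T" for i j
      proof -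
        have "x0 $ i - x0 $ j = real m" using x0 that by (auto simp: tie_space_def)
        then show ?thesis by (simp add: algebra_simps)
      qed
      moreover have "x \<in> sum_zero \<longleftrightarrow> x - x0 \<in> sum_zero"
        using x0 by (simp add: tie_space_def sum_zero_def sum_subtractf)
      ultimately show ?thesis
        unfolding V unfolding tie_space_def by blast
    qed
    then show ?thesis
      by (metis (no_types, lifting) add_diff_cancel_left' diff_add_cancel add.commute image_iff subsetI subset_antisym)
  qed
  then show ?thesis
    using aff_dim_subspace[OF \<open>subspace ?V\<close>] dim by (simp add: aff_dim_translation_eq)
qed

section \<open>Cells as relatively open subsets of tie spaces\<close>

definition sign_set :: "('n \<times> 'n \<times> nat) set \<Rightarrow> 'n description \<Rightarrow> (real ^ 'n) set" where
  "sign_set K s = {y. \<forall>(i, j, k)\<in>K. sgn (y $ i - y $ j - real k) = s i j k}"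

lemma open_sign_set:
  fixes s :: "'n::finite description"
  assumes "finite K" "\<And>i j k. (i, j, k) \<in> K \<Longrightarrow> s i j k \<noteq> 0"
  shows "open (sign_set K s)"
proof -
  have "open {y :: real ^ 'n. sgn (y $ i - y $ j - real k) = c}" if "c \<noteq> 0" for i j k c
  proof -
    consider "c = 1" | "c = -1" | "c \<notin> {1, -1}" by blast
    then show ?thesis
    proof cases
      case 1
      then have "{y :: real ^ 'n. sgn (y $ i - y $ j - real k) = c} = {y. real k < y $ i - y $ j}"
        by (auto simp: sgn_if)
      then show ?thesis by (auto intro!: open_Collect_less continuous_intros)
    next
      case 2
      then have "{y :: real ^ 'n. sgn (y $ i - y $ j - real k) = c} = {y. y $ i - y $ j < real k}"
        by (auto simp: sgn_if)
      then show ?thesis by (auto intro!: open_Collect_less continuous_intros)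
    next
      case 3
      then have "{y :: real ^ 'n. sgn (y $ i - y $ j - real k) = c} = {}"
        using that by (auto simp: sgn_if)
      then show ?thesis by simp
    qed
  qed
  moreover have "sign_set K s = (\<Inter>(i, j, k)\<in>K. {y. sgn (y $ i - y $ j - real k) = s i j k})"
    by (auto simp: sign_set_def)
  ultimately show ?thesis
    using assms by (auto intro!: open_INT)
qed

definition signs :: "real ^ 'n \<Rightarrow> 'n description" where
  "signs x = (\<lambda>i j k. sgn (x $ i - x $ j - real k))"

definition regular_point :: "nat \<Rightarrow> real ^ 'n::{finite,linorder} \<Rightarrow> bool" where
  "regular_point m x \<longleftrightarrow> x \<in> sum_zero \<and>
     (\<forall>i j. i < j \<longrightarrow> x $ j < x $ i \<and> (\<forall>k\<in>{1..<m}. x $ i - x $ j \<noteq> real k))"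

definition ties :: "nat \<Rightarrow> real ^ 'n::{finite,linorder} \<Rightarrow> ('n \<times> 'n) set" where
  "ties m x = {(i, j). i < j \<and> x $ i - x $ j = real m}"

text \<open>Includes \<open>k = 0\<close>, which encodes \<open>x\<^sub>i > x\<^sub>j\<close>.\<close>

definition strict_signs :: "nat \<Rightarrow> real ^ 'n::{finite,linorder} \<Rightarrow> ('n \<times> 'n \<times> nat) set" where
  "strict_signs m x = {(i, j, k). i < j \<and> k \<le> m \<and> x $ i - x $ j \<noteq> real k}"

lemma finite_strict_signs: "finite (strict_signs m x)"
  by (rule finite_subset[of _ "UNIV \<times> UNIV \<times> {..m}"]) (auto simp: strict_signs_def)

lemma open_strict_sign_set:
  "K \<subseteq> strict_signs m x \<Longrightarrow> open (sign_set K (signs x))"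
  by (rule open_sign_set[OF finite_subset[OF _ finite_strict_signs]])
    (auto simp: strict_signs_def signs_def sgn_zero_iff)

text \<open>At a regular point only the levels \<open>k = m\<close> can be equations. These cut out
  the tie space, and all other conditions are strict and hence open.\<close>

lemma cell_signs_eq:
  assumes "m > 0" "regular_point m x"
  shows "cell m (signs x) = tie_space m (ties m x) \<inter> sign_set (strict_signs m x) (signs x)"
proof (rule set_eqI)
  fix y
  have pos: "sgn (x $ i - x $ j) = 1" if "i < j" for i j
    using assms that by (simp add: regular_point_def)
  have iff: "(y $ i - y $ j > 0 \<and> (\<forall>k\<in>{1..m}. sgn (y $ i - y $ j - real k) = signs x i j k)) \<longleftrightarrow>
      (\<forall>k\<le>m. sgn (y $ i - y $ j - real k) = signs x i j k)" if "i < j" for i j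
  proof -
    have "(\<forall>k\<le>m. sgn (y $ i - y $ j - real k) = signs x i j k) \<longleftrightarrow>
        sgn (y $ i - y $ j - real 0) = signs x i j 0 \<and>
        (\<forall>k\<in>{1..m}. sgn (y $ i - y $ j - real k) = signs x i j k)"
      by (metis One_nat_def Suc_leI atLeastAtMost_iff neq0_conv zero_le)
    then show ?thesis using pos[OF that] by (simp add: signs_def sgn_1_pos)
  qed
  have tie: "sgn (y $ i - y $ j - real k) = signs x i j k \<longleftrightarrow> y $ i - y $ j = real k"
    if "x $ i - x $ j = real k" for i j k
    using that by (simp add: signs_def sgn_zero_iff)
  have k: "k = m" if "i < j" "k \<le> m" "x $ i - x $ j = real k" for i j k
  proof (rule ccontr)
    assume "k \<noteq> m"
    moreover have "x $ j < x $ i" using assms that by (auto simp: regular_point_def)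
    then have "k \<noteq> 0" using that by auto
    ultimately show False using assms that by (auto simp: regular_point_def)
  qed
  have "y \<in> cell m (signs x) \<longleftrightarrow>
      y \<in> sum_zero \<and> (\<forall>i j. i < j \<longrightarrow> (\<forall>k\<le>m. sgn (y $ i - y $ j - real k) = signs x i j k))"
    unfolding cell_def using iff by blast
  also have "\<dots> \<longleftrightarrow> y \<in> tie_space m (ties m x) \<inter> sign_set (strict_signs m x) (signs x)"
    (is "?L \<longleftrightarrow> ?R")
  proof
    assume L: ?L
    then have "y $ i - y $ j = real m" if "(i, j) \<in> ties m x" for i j
      using tie[of i j m] that by (simp add: ties_def)
    then show ?R
      using L by (auto simp: tie_space_def sign_set_def strict_signs_def)
  next
    assume R: ?R
    have "sgn (y $ i - y $ j - real k) = signs x i j k" if "i < j" "k \<le> m" for i j k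
    proof (cases "x $ i - x $ j = real k")
      case True
      then have "y $ i - y $ j = real k"
        using k[OF that True] R that by (auto simp: tie_space_def ties_def)
      then show ?thesis using tie[OF True] by blast
    next
      case False
      then show ?thesis using R that by (auto simp: sign_set_def strict_signs_def)
    qed
    then show ?L using R by (simp add: tie_space_def)
  qed
  finally show "y \<in> cell m (signs x) \<longleftrightarrow> y \<in> tie_space m (ties m x) \<inter> sign_set (strict_signs m x) (signs x)" .
qed

lemma self_in_cell: "regular_point m x \<Longrightarrow> x \<in> cell m (signs x)"
  by (simp add: cell_def signs_def regular_point_def)

lemma admissible_signs: "regular_point m x \<Longrightarrow> admissible m (signs x)"
  by (auto simp: admissible_def signs_def regular_point_def sgn_if)

text \<open>Any point of a flat recovers the relevant signs of its description, so a flat may be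
  represented by one of its points.\<close>

lemma Flat_iff: "F \<in> Flat m \<longleftrightarrow> (\<exists>x. regular_point m x \<and> F = cell m (signs x))"
proof
  assume "F \<in> Flat m"
  then obtain s x where s: "F = cell m s" "admissible m s" "x \<in> cell m s"
    by (auto simp: Flat_def)
  have eq: "signs x i j k = s i j k" if "i < j" "k \<in> {1..m}" for i j k
    using s(3) that by (auto simp: cell_def signs_def)
  then have "cell m s = cell m (signs x)"
    unfolding cell_def by auto
  moreover have "x $ i - x $ j \<noteq> real k" if "i < j" "k \<in> {1..<m}" for i j k
  proof
    assume "x $ i - x $ j = real k"
    then have "s i j k = 0"
      using eq[of i j k] that by (simp add: signs_def)
    moreover have "s i j k \<in> {1, -1}"
      using s(2) that unfolding admissible_def by blast
    ultimately show False by simp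
  qed
  then have "regular_point m x"
    using s(3) by (auto simp: regular_point_def cell_def)
  ultimately show "\<exists>x. regular_point m x \<and> F = cell m (signs x)"
    using s(1) by blast
next
  assume "\<exists>x. regular_point m x \<and> F = cell m (signs x)"
  then show "F \<in> Flat m"
    using self_in_cell admissible_signs by (fastforce simp: Flat_def)
qed

text \<open>The coordinates of a regular point are distinct, so at most one of them lies at distance
  \<open>m\<close> below a given one.\<close>

lemma inj_on_fst_ties:
  assumes "regular_point m x" shows "inj_on fst (ties m x)"
proof -
  have "j = j'" if "x $ i - x $ j = real m" "x $ i - x $ j' = real m" for i j j'
  proof (rule ccontr)
    assume "j \<noteq> j'"
    then have "x $ j \<noteq> x $ j'"
      using assms by (metis less_irrefl linorder_less_linear regular_point_def)
    then show False using that by simp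
  qed
  then show ?thesis by (auto simp: inj_on_def ties_def)
qed

text \<open>A non-empty relatively open part of the tie space has its full dimension, so every tie
  costs exactly one.\<close>

lemma aff_dim_Flat:
  fixes x :: "real ^ 'n::{finite,linorder}"
  assumes "m > 0" "regular_point m x"
  shows "aff_dim (cell m (signs x)) = int CARD('n) - 1 - int (card (ties m x))"
proof -
  note eq = cell_signs_eq[OF assms]
  have x: "x \<in> cell m (signs x)" by (rule self_in_cell) fact
  have "aff_dim (cell m (signs x)) = aff_dim (tie_space m (ties m x))"
    using x unfolding eq
    by (intro aff_dim_convex_Int_open convex_tie_space open_strict_sign_set) auto
  also have "\<dots> = int CARD('n) - 1 - int (card (ties m x))"
    by (rule aff_dim_tie_space) (use x inj_on_fst_ties[OF assms(2)] in \<open>auto simp: eq ties_def\<close>)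
  finally show ?thesis .
qed

section \<open>Walls between consecutive coordinates\<close>

lemma hyp_eq_tie_space: "hyp i j (int m) = tie_space m {(i, j)}"
  by (auto simp: hyp_def tie_space_def)

text \<open>The projection onto \<open>sum_zero\<close> along the all-ones vector; it preserves
  coordinate differences.\<close>

definition centered :: "real ^ 'n \<Rightarrow> real ^ 'n" where
  "centered x = (\<chi> i. x $ i - (\<Sum>j\<in>UNIV. x $ j) / real CARD('n))"

lemma centered_in_sum_zero: "centered x \<in> sum_zero"
  by (simp add: centered_def sum_zero_def sum_subtractf)

lemma centered_diff: "centered x $ i - centered x $ j = x $ i - x $ j"
  by (simp add: centered_def)

text \<open>
  Lowering all coordinates up to \<open>i\<close> by \<open>x\<^sub>i - x\<^sub>j - m\<close> moves \<open>x\<close> onto the hyperplane and crosses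
  no other one, because \<open>i\<close> and \<open>j\<close> are consecutive. Hence separation already implies being a wall.
\<close>

lemma is_wall_simple:
  fixes x :: "real ^ 'n::{finite,linorder}"
  assumes m: "m > 0" and x: "regular_point m x" "ties m x = {}"
    and ij: "consecutive i j" "x $ i - x $ j > real m"
  shows "is_wall m (cell m (signs x)) (hyp i j (int m))"
proof -
  let ?R = "cell m (signs x)" and ?H = "hyp i j (int m)"
  have lt: "i < j" using ij by (simp add: consecutive_def)
  have R: "?R = sum_zero \<inter> sign_set (strict_signs m x) (signs x)"
    using cell_signs_eq[OF m x(1)] x(2) by (simp add: tie_space_def)
  have xR: "x \<in> ?R" by (rule self_in_cell) fact
  have xs: "x $ b < x $ a" if "a < b" for a b using x(1) that by (simp add: regular_point_def)
  have convR: "convex ?R"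
  proof -
    have "convex {y :: real ^ 'n::{finite,linorder}. sgn (y $ a - y $ b - real k) = c}" for a b k c
    proof -
      have "{y :: real ^ 'n::{finite,linorder}. sgn (y $ a - y $ b - real k) = c} =
          (\<lambda>y. y $ a - y $ b) -` {r. sgn (r - real k) = c}" by auto
      moreover have "linear (\<lambda>y :: real ^ 'n::{finite,linorder}. y $ a - y $ b)"
        by (auto intro!: linearI simp: algebra_simps)
      moreover have "convex {r. sgn (r - real k) = c}"
      proof -
        have "is_interval {r. sgn (r - real k) = c}"
          unfolding is_interval_1 by (auto simp: sgn_if split: if_splits)
        then show ?thesis by (simp add: is_interval_convex)
      qed
      ultimately show ?thesis by (simp only: convex_linear_vimage)
    qed
    moreover have "sign_set (strict_signs m x) (signs x) =
        (\<Inter>(a, b, k)\<in>strict_signs m x. {y. sgn (y $ a - y $ b - real k) = signs x a b k})"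
      by (auto simp: sign_set_def)
    moreover have "convex (sum_zero :: (real ^ 'n::{finite,linorder}) set)"
      using convex_tie_space[of m "{}"] by (simp add: tie_space_def)
    ultimately show ?thesis unfolding R by (auto intro!: convex_Int convex_INT)
  qed
  have dimR: "aff_dim (closure ?R) = int CARD('n) - 1"
    using aff_dim_Flat[OF m x(1)] x(2) by simp
  have Hne: "strict_signs m x - {(i, j, m)} \<subseteq> strict_signs m x" by blast
  \<comment> \<open>Only the condition across \<open>?H\<close> is dropped, so
    \<open>?H \<inter> ?O\<close> is a relatively open part of the hyperplane; it will turn out to
    border the region.\<close>
  let ?O = "sign_set (strict_signs m x - {(i, j, m)}) (signs x)"
  define z where "z = centered (\<chi> a. if a \<le> i then x $ a - (x $ i - x $ j - real m) else x $ a)"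
  have z: "z $ a - z $ b = (x $ a - x $ b) -
      (if a \<le> i then x $ i - x $ j - real m else 0) + (if b \<le> i then x $ i - x $ j - real m else 0)" for a b
    by (simp add: z_def centered_diff)
  have cons: "j \<le> b" if "\<not> b \<le> i" for b
    using that ij(1) by (meson consecutive_def not_le)
  have zH: "z \<in> ?H"
    using z[of i j] lt centered_in_sum_zero by (auto simp: hyp_def z_def)
  have zO: "z \<in> ?O"
  proof -
    have "sgn (z $ a - z $ b - real k) = sgn (x $ a - x $ b - real k)"
      if ab: "a < b" "k \<le> m" "x $ a - x $ b \<noteq> real k" "(a, b, k) \<noteq> (i, j, m)" for a b k
    proof (cases "a \<le> i \<and> \<not> b \<le> i")
      \<comment> \<open>Such a pair straddles the cut, so its difference is at least
        \<open>x $ i - x $ j\<close> and drops by \<open>x $ i - x $ j - m\<close>. It stays above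
        \<open>m\<close>, or becomes \<open>m\<close> for the pair \<open>(i, j)\<close>, whose
        level \<open>m\<close> is excluded.\<close>
      case True
      then have "j \<le> b" using cons by blast
      have 1: "x $ i \<le> x $ a" "x $ b \<le> x $ j"
        using True \<open>j \<le> b\<close> xs by (force simp: le_less)+
      have 2: "x $ i < x $ a \<or> x $ b < x $ j" if "(a, b) \<noteq> (i, j)"
        using True \<open>j \<le> b\<close> xs that by (force simp: le_less)
      have "real k < x $ a - x $ b" using 1 ij ab(2) by simp
      moreover have "real k < z $ a - z $ b"
      proof (cases "(a, b) = (i, j)")
        case True
        then show ?thesis using ab lt z[of i j] by auto
      next
        case False
        then show ?thesis using 1 2 True z[of a b] ab(2) by auto
      qed
      ultimately show ?thesis by simp
    next
      case False
      then show ?thesis using z[of a b] ab(1) by auto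
    qed
    then show ?thesis by (auto simp: sign_set_def strict_signs_def signs_def)
  qed
  have sub: "?H \<inter> ?O \<subseteq> closure ?R"
  proof
    fix y assume y: "y \<in> ?H \<inter> ?O"
    \<comment> \<open>Moving from \<open>y\<close> towards \<open>x\<close> enters the region at
      once, so \<open>y\<close> is a limit of its points.\<close>
    have "open_segment y x \<subseteq> ?R"
    proof
      fix w assume "w \<in> open_segment y x"
      then obtain c where c: "0 < c" "c < 1" "w = (1 - c) *\<^sub>R y + c *\<^sub>R x"
        by (auto simp: in_segment)
      have w: "w $ a - w $ b - real k = (1 - c) * (y $ a - y $ b - real k) + c * (x $ a - x $ b - real k)"
        for a b k unfolding c(3) by (simp add: algebra_simps)
      \<comment> \<open>At \<open>y\<close> the condition for \<open>(i, j, m)\<close> vanishes and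
        the others have the sign at \<open>x\<close>; a positive share of \<open>x\<close> yields
        that sign in all cases.\<close>
      have comb: "sgn ((1 - c) * p + c * q) = sgn q" if "sgn p = sgn q \<or> p = 0" for p q :: real
      proof -
        have "0 \<le> p \<Longrightarrow> 0 \<le> (1 - c) * p" "p \<le> 0 \<Longrightarrow> (1 - c) * p \<le> 0"
          "0 < q \<Longrightarrow> 0 < c * q" "q < 0 \<Longrightarrow> c * q < 0"
          using c(1,2) by (auto simp: mult_nonneg_nonpos mult_pos_neg)
        moreover have "q = 0 \<Longrightarrow> p = 0" "0 < q \<Longrightarrow> 0 \<le> p" "q < 0 \<Longrightarrow> p \<le> 0"
          using that by (auto simp: sgn_if split: if_splits)
        ultimately show ?thesis
          by (cases q "0 :: real" rule: linorder_cases) (simp_all add: add_nonpos_neg add_nonneg_pos)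
      qed
      have "sgn (w $ a - w $ b - real k) = signs x a b k" if "(a, b, k) \<in> strict_signs m x" for a b k
      proof -
        have "sgn (y $ a - y $ b - real k) = sgn (x $ a - x $ b - real k) \<or> y $ a - y $ b - real k = 0"
        proof (cases "(a, b, k) = (i, j, m)")
          case True
          then show ?thesis using y by (simp add: hyp_def)
        next
          case False
          then show ?thesis using y that by (fastforce simp: sign_set_def signs_def)
        qed
        from comb[OF this] show ?thesis unfolding w signs_def .
      qed
      moreover have "w \<in> sum_zero"
        using y xR by (simp add: c(3) hyp_def cell_def sum_zero_def sum.distrib flip: sum_distrib_left)
      ultimately show "w \<in> ?R" unfolding R by (auto simp: sign_set_def)
    qed
    then have "closure (open_segment y x) \<subseteq> closure ?R" by (rule closure_mono)
    moreover have "y \<noteq> x" using y ij(2) by (auto simp: hyp_def)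
    ultimately show "y \<in> closure ?R" by auto
  qed
  have "aff_dim (?H \<inter> closure ?R) = int CARD('n) - 2"
  proof (rule antisym)
    have H: "aff_dim ?H = int CARD('n) - 2"
      using aff_dim_tie_space[of "{(i, j)}" m] lt zH unfolding hyp_eq_tie_space by auto
    show "aff_dim (?H \<inter> closure ?R) \<le> int CARD('n) - 2"
      using aff_dim_subset[of "?H \<inter> closure ?R" ?H] H by simp
    \<comment> \<open>The relatively open part already has the dimension of the hyperplane, which
      gives the lower bound.\<close>
    have "aff_dim (?H \<inter> ?O) = aff_dim ?H"
      using zH zO open_strict_sign_set[OF Hne] convex_tie_space
      by (intro aff_dim_convex_Int_open) (auto simp: hyp_eq_tie_space)
    then show "int CARD('n) - 2 \<le> aff_dim (?H \<inter> closure ?R)"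
      using aff_dim_subset[of "?H \<inter> ?O" "?H \<inter> closure ?R"] sub H by auto
  qed
  moreover have "(?H \<inter> closure ?R) face_of closure ?R"
  proof -
    let ?a = "axis i 1 - axis j 1 :: real ^ 'n::{finite,linorder}"
    have a: "?a \<bullet> y = y $ i - y $ j" for y
      by (simp add: inner_diff_left inner_axis')
    \<comment> \<open>The region lies on one side of \<open>?H\<close>, so the hyperplane supports
      its closure.\<close>
    have "closure ?R \<subseteq> sum_zero \<inter> {y. ?a \<bullet> y \<ge> real m}"
    proof (rule closure_minimal)
      have "(i, j, m) \<in> strict_signs m x" using lt ij by (auto simp: strict_signs_def)
      then show "?R \<subseteq> sum_zero \<inter> {y. ?a \<bullet> y \<ge> real m}"
        unfolding R a using ij(2) by (force simp: sign_set_def signs_def sgn_1_pos)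
      have "closed (sum_zero :: (real ^ 'n::{finite,linorder}) set)"
        unfolding sum_zero_def by (intro closed_Collect_eq continuous_intros)
      then show "closed (sum_zero \<inter> {y. ?a \<bullet> y \<ge> real m})"
        using closed_halfspace_ge[of "real m" ?a] by (intro closed_Int) auto
    qed
    moreover from this have "?H \<inter> closure ?R = closure ?R \<inter> {y. ?a \<bullet> y = real m}"
      by (auto simp: hyp_def a)
    ultimately show ?thesis
      using face_of_Int_supporting_hyperplane_ge[of "closure ?R" "real m" ?a] convR by auto
  qed
  moreover have "?H \<inter> closure ?R \<noteq> {}" using sub zH zO by blast
  moreover have "?H \<in> catalan_arrangement m"
    unfolding catalan_arrangement_def using lt by force
  ultimately show ?thesis
    using dimR by (simp add: is_wall_def facet_of_def)
qed

text \<open>The perturbation is \<open>(1 + d) x\<close> for small \<open>d > 0\<close>, which turns each \<open>x\<^sub>i - x\<^sub>j = m\<close> into \<open>> m\<close>.\<close>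

lemma open_ties_perturbation:
  fixes x :: "real ^ 'n::{finite,linorder}"
  assumes m: "m > 0" and x: "regular_point m x"
  obtains y where "regular_point m y" "ties m y = {}"
    "cell m (equalities_to_greater (signs x)) = cell m (signs y)"
    "\<And>i j. i < j \<Longrightarrow> y $ i - y $ j > real m \<longleftrightarrow> x $ i - x $ j \<ge> real m"
proof -
  let ?O = "sign_set (strict_signs m x) (signs x)"
  have "open ?O" "x \<in> ?O"
    using open_strict_sign_set[OF order_refl] by (auto simp: sign_set_def signs_def)
  then obtain e where e: "e > 0" "ball x e \<subseteq> ?O" by (meson openE)
  \<comment> \<open>The summand \<open>1\<close> keeps the denominator positive even for
    \<open>x = 0\<close> and makes \<open>d * norm x < e\<close> strict.\<close>
  define d where "d = e / (norm x + 1)"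
  have d: "d > 0" unfolding d_def using e(1) by (simp add: add_nonneg_pos)
  define y where "y = (1 + d) *\<^sub>R x"
  have "dist x y = d * norm x"
    using d by (simp add: y_def dist_norm algebra_simps)
  also have "\<dots> < d * (norm x + 1)" using d by simp
  also have "\<dots> = e" using norm_ge_zero[of x] by (simp add: d_def add_nonneg_eq_0_iff)
  finally have "y \<in> ?O" using e(2) by auto
  have yd: "y $ i - y $ j = (1 + d) * (x $ i - x $ j)" for i j
    by (simp add: y_def algebra_simps)
  have sgn: "sgn (y $ i - y $ j - real k) = (if x $ i - x $ j = real k then 1 else sgn (x $ i - x $ j - real k))"
    if "i < j" "k \<in> {1..m}" for i j k
  proof (cases "x $ i - x $ j = real k")
    case True
    then have "y $ i - y $ j - real k = d * real k" by (simp add: yd algebra_simps)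
    then show ?thesis using d that True by (simp add: sgn_mult)
  next
    case False
    then have "(i, j, k) \<in> strict_signs m x" using that by (auto simp: strict_signs_def)
    then show ?thesis using \<open>y \<in> ?O\<close> False by (auto simp: sign_set_def signs_def)
  qed
  have ne: "y $ i - y $ j \<noteq> real k" if "i < j" "k \<in> {1..m}" for i j k
    using sgn[OF that] by (auto simp: sgn_zero_iff split: if_splits)
  show ?thesis
  proof (rule that[of y])
    have "y \<in> sum_zero"
      using x by (simp add: y_def regular_point_def sum_zero_def flip: sum_distrib_left)
    moreover have "y $ j < y $ i" if "i < j" for i j
    proof -
      have "0 < (1 + d) * (x $ i - x $ j)"
        using x d that by (simp add: regular_point_def)
      then show ?thesis using yd[of i j] by simp
    qed
    ultimately show "regular_point m y"
      using ne by (auto simp: regular_point_def)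
    show "ties m y = {}" using ne m by (auto simp: ties_def)
    show "cell m (equalities_to_greater (signs x)) = cell m (signs y)"
    proof -
      have "equalities_to_greater (signs x) i j k = signs y i j k" if "i < j" "k \<in> {1..m}" for i j k
        using sgn[OF that] by (simp add: equalities_to_greater_def signs_def sgn_zero_iff)
      then show ?thesis unfolding cell_def by auto
    qed
    show "y $ i - y $ j > real m \<longleftrightarrow> x $ i - x $ j \<ge> real m" if "i < j" for i j
      using sgn[OF that, of m] m by (auto simp: sgn_if split: if_splits)
  qed
qed

text \<open>The vector \<open>z\<close>, which drops by \<open>m\<close> just after
  \<open>i\<close>, lies on the first hyperplane. Lying on the second forces
  \<open>a \<le> i < b\<close>, and consecutiveness leaves only \<open>a = i\<close>.\<close>

lemma consecutive_hyp_inject: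
  fixes i j :: "'n::{finite,linorder}"
  assumes "m > 0" "consecutive i j" "consecutive a b" "hyp i j (int m) = hyp a b (int m)"
  shows "(i, j) = (a, b)"
proof -
  define z :: "real ^ 'n::{finite,linorder}" where "z = centered (\<chi> c. if c \<le> i then real m else 0)"
  have z: "z $ c - z $ d = (if c \<le> i then real m else 0) - (if d \<le> i then real m else 0)" for c d
    by (simp add: z_def centered_diff)
  have "z \<in> hyp i j (int m)"
    using z[of i j] assms(2) centered_in_sum_zero by (auto simp: hyp_def z_def consecutive_def)
  then have "z $ a - z $ b = real m" using assms(4) by (auto simp: hyp_def)
  then have "a \<le> i" "i < b" using z[of a b] assms(1) by (auto split: if_splits)
  then have "a = i"
    using assms(3) unfolding consecutive_def by (metis order_le_less)
  moreover from this have "b = j"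
    using assms(2,3) unfolding consecutive_def by (metis linorder_less_linear)
  ultimately show ?thesis by simp
qed

definition gaps :: "nat \<Rightarrow> real ^ 'n::{finite,linorder} \<Rightarrow> ('n \<times> 'n) set" where
  "gaps m x = {(i, j). consecutive i j \<and> x $ i - x $ j > real m}"

text \<open>The simple separating walls of the region are the consecutive pairs with difference at
  least \<open>m\<close> at \<open>x\<close>. Those with difference equal to \<open>m\<close>
  contain the flat and are removed.\<close>

lemma ssw_eq:
  assumes m: "m > 0" and x: "regular_point m x"
  shows "ssw m (cell m (signs x)) = card (gaps m x)"
proof -
  let ?F = "cell m (signs x)"
  obtain y where y: "regular_point m y" "ties m y = {}"
    and R: "cell m (equalities_to_greater (signs x)) = cell m (signs y)"
    and gt: "\<And>i j. i < j \<Longrightarrow> y $ i - y $ j > real m \<longleftrightarrow> x $ i - x $ j \<ge> real m"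
    using open_ties_perturbation[OF m x] by blast
  have xF: "x \<in> ?F" by (rule self_in_cell) fact
  have region: "region_of m ?F = cell m (signs y)"
    using region_of_cell[OF admissible_signs[OF x]] xF R by auto
  have wall: "is_wall m (cell m (signs y)) (hyp i j (int m)) \<and>
      separates_origin (cell m (signs y)) i j (int m) \<longleftrightarrow> x $ i - x $ j \<ge> real m"
    if ij: "consecutive i j" for i j
  proof -
    have lt: "i < j" using ij by (simp add: consecutive_def)
    have "separates_origin (cell m (signs y)) i j (int m) \<longleftrightarrow> y $ i - y $ j > real m"
    proof
      assume "separates_origin (cell m (signs y)) i j (int m)"
      then show "y $ i - y $ j > real m"
        using self_in_cell[OF y(1)] by (auto simp: separates_origin_def)
    next
      assume "y $ i - y $ j > real m"
      moreover have "sgn (w $ i - w $ j - real m) = sgn (y $ i - y $ j - real m)"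
        if "w \<in> cell m (signs y)" for w
        using that lt m by (simp add: cell_def signs_def)
      ultimately show "separates_origin (cell m (signs y)) i j (int m)"
        using m by (simp add: separates_origin_def sgn_1_pos)
    qed
    then show ?thesis using is_wall_simple[OF m y ij] gt[OF lt] by blast
  qed
  have contains: "hyp i j (int m) \<in> containing_hyps m ?F \<longleftrightarrow> x $ i - x $ j = real m"
    if ij: "consecutive i j" for i j
  proof
    assume "hyp i j (int m) \<in> containing_hyps m ?F"
    then have "x \<in> hyp i j (int m)" using xF by (auto simp: containing_hyps_def)
    then show "x $ i - x $ j = real m" by (simp add: hyp_def)
  next
    assume eq: "x $ i - x $ j = real m"
    have lt: "i < j" using ij by (simp add: consecutive_def)
    have "?F \<subseteq> hyp i j (int m)"
    proof
      fix w assume w: "w \<in> ?F"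
      then have "sgn (w $ i - w $ j - real m) = 0"
        using lt m eq by (auto simp: cell_def signs_def)
      then show "w \<in> hyp i j (int m)" using w by (simp add: hyp_def cell_def sgn_zero_iff)
    qed
    then show "hyp i j (int m) \<in> containing_hyps m ?F"
      using lt by (auto simp: containing_hyps_def)
  qed
  have "simple_separating_walls m (region_of m ?F) - containing_hyps m ?F =
      (\<lambda>(i, j). hyp i j (int m)) ` gaps m x"
    unfolding region simple_separating_walls_def gaps_def
    using wall contains by (fastforce simp: le_less image_iff)
  moreover have "inj_on (\<lambda>(i, j). hyp i j (int m)) (gaps m x)"
    using consecutive_hyp_inject[OF m] by (fastforce simp: inj_on_def gaps_def)
  ultimately show ?thesis
    by (simp add: ssw_def card_image)
qed

section \<open>Flats and configurations\<close>

text \<open>The zero-based rank, which identifies the index type with the positions of a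
  list.\<close>

definition coord_index :: "'n::{finite,linorder} \<Rightarrow> nat" where
  "coord_index i = card {j. j < i}"

lemma coord_index_less_iff: "coord_index i < coord_index j \<longleftrightarrow> i < j"
proof -
  have "coord_index i < coord_index j" if "i < j" for i j :: "'n::{finite,linorder}"
    unfolding coord_index_def by (rule psubset_card_mono) (use that in auto)
  then show ?thesis by (metis less_asym linorder_less_linear)
qed

lemma inj_coord_index: "inj coord_index"
  by (rule injI) (metis less_irrefl linorder_less_linear coord_index_less_iff)

lemma range_coord_index: "range (coord_index :: 'n::{finite,linorder} \<Rightarrow> nat) = {..<CARD('n)}"
proof (rule card_subset_eq)
  have "coord_index i < CARD('n)" for i :: 'n
    unfolding coord_index_def by (rule psubset_card_mono) auto
  then show "range (coord_index :: 'n \<Rightarrow> nat) \<subseteq> {..<CARD('n)}" by auto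
qed (simp_all add: card_image inj_coord_index)

lemma coord_index_exhaust:
  assumes "p < CARD('n)" obtains i :: "'n::{finite,linorder}" where "p = coord_index i"
  using assms range_coord_index[where 'n = 'n] by (metis imageE lessThan_iff)

lemma coord_index_less_card: "coord_index (i :: 'n::{finite,linorder}) < CARD('n)"
  using range_coord_index[where 'n = 'n] by blast

lemma consecutive_iff_coord_index: "consecutive i j \<longleftrightarrow> coord_index j = Suc (coord_index i)"
proof
  assume c: "consecutive i j"
  then have "{k. k < j} = insert i {k. k < i}"
    unfolding consecutive_def by (auto, metis linorder_less_linear)
  then show "coord_index j = Suc (coord_index i)" by (simp add: coord_index_def)
next
  assume "coord_index j = Suc (coord_index i)"
  then show "consecutive i j"
    unfolding consecutive_def by (metis lessI not_less_eq coord_index_less_iff less_asym)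
qed

section \<open>Flats parametrised by configurations\<close>

definition point_of :: "real list \<Rightarrow> real ^ 'n::{finite,linorder}" where
  "point_of xs = centered (\<chi> i. xs ! coord_index i)"

lemma point_of_diff:
  fixes i j :: "'n::{finite,linorder}"
  shows "point_of xs $ i - point_of xs $ j = xs ! coord_index i - xs ! coord_index j"
  by (simp add: point_of_def centered_diff)

lemma regular_point_of:
  assumes "generic m xs" "length xs = CARD('n)"
  shows "regular_point m (point_of xs :: real ^ 'n::{finite,linorder})"
proof -
  have "point_of xs $ j < point_of xs $ i" if "i < j" for i j :: 'n
    using generic_nth_less[OF assms(1), of "coord_index i" "coord_index j"] coord_index_less_card[of j] that assms(2)
      point_of_diff[of xs i j] by (simp add: coord_index_less_iff)
  moreover have "point_of xs $ i - point_of xs $ j \<noteq> real k" if "k \<in> {1..<m}" for i j :: 'n and k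
    using assms that coord_index_less_card[of i] coord_index_less_card[of j]
    unfolding point_of_diff generic_def by (metis nth_mem)
  ultimately show ?thesis
    using centered_in_sum_zero by (auto simp: regular_point_def point_of_def)
qed

lemma cell_cong:
  "(\<And>i j k. i < j \<Longrightarrow> k \<in> {1..m} \<Longrightarrow> s i j k = s' i j k) \<Longrightarrow> cell m s = cell m s'"
  unfolding cell_def by auto

lemma same_signs_iff_signs:
  assumes "length xs = CARD('n)" "length ys = CARD('n)"
  shows "same_signs m xs ys \<longleftrightarrow>
    (\<forall>i j :: 'n::{finite,linorder}. \<forall>k\<in>{1..m}. i < j \<longrightarrow> signs (point_of xs) i j k = signs (point_of ys) i j k)"
    (is "_ \<longleftrightarrow> ?R")
proof
  assume "same_signs m xs ys"
  then show ?R
    using assms by (simp add: same_signs_def signs_def point_of_diff coord_index_less_iff coord_index_less_card)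
next
  assume R: ?R
  have "sgn (xs ! p - xs ! q - real k) = sgn (ys ! p - ys ! q - real k)"
    if pq: "p < q" "q < CARD('n)" "k \<in> {1..m}" for p q k
  proof -
    obtain i where i: "p = coord_index (i :: 'n)"
      using coord_index_exhaust[OF less_trans[OF pq(1,2)]] by blast
    obtain j where j: "q = coord_index (j :: 'n)"
      using coord_index_exhaust[OF pq(2)] by blast
    from i j show ?thesis
      using R pq by (auto simp: signs_def point_of_diff coord_index_less_iff)
  qed
  then show "same_signs m xs ys"
    using assms by (simp add: same_signs_def)
qed

lemma cell_point_of_eq_iff:
  assumes "generic m xs" "length xs = CARD('n)" "generic m ys" "length ys = CARD('n)"
  shows "cell m (signs (point_of xs :: real ^ 'n::{finite,linorder})) = cell m (signs (point_of ys)) \<longleftrightarrow>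
    same_signs m xs ys"
proof
  assume eq: "cell m (signs (point_of xs :: real ^ 'n::{finite,linorder})) = cell m (signs (point_of ys))"
  have "point_of xs \<in> cell m (signs (point_of ys :: real ^ 'n::{finite,linorder}))"
    using self_in_cell[OF regular_point_of[OF assms(1,2)]] eq by simp
  then show "same_signs m xs ys"
    by (simp add: same_signs_iff_signs[OF assms(2,4)] cell_def) (simp add: signs_def)
next
  assume "same_signs m xs ys"
  then show "cell m (signs (point_of xs :: real ^ 'n::{finite,linorder})) = cell m (signs (point_of ys))"
    by (intro cell_cong) (simp add: same_signs_iff_signs[OF assms(2,4)])
qed

text \<open>Two configurations define the same cell exactly when their sign patterns agree, so the
  bijection follows from existence and uniqueness of the canonical configuration.\<close>

lemma bij_betw_configs_Flat:
  assumes "m > 0"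
  shows "bij_betw (\<lambda>xs. cell m (signs (point_of xs))) (configs m (CARD('n) - 1))
    (Flat m :: (real ^ 'n::{finite,linorder}) set set)"
proof -
  have config: "generic m xs" "length xs = CARD('n)" if "xs \<in> configs m (CARD('n) - 1)" for xs
    using configs_generic[OF that] by auto
  have "F \<in> (\<lambda>xs. cell m (signs (point_of xs))) ` configs m (CARD('n) - 1)"
    if F: "F \<in> Flat m" for F :: "(real ^ 'n::{finite,linorder}) set"
  proof -
    obtain x :: "real ^ 'n::{finite,linorder}" where x: "regular_point m x" "F = cell m (signs x)"
      using F by (auto simp: Flat_iff)
    \<comment> \<open>The coordinates of \<open>x\<close> in index order, hence decreasing.\<close>
    define ys where "ys = map (\<lambda>p. x $ inv coord_index p) [0..<CARD('n)]"
    have ys: "length ys = CARD('n)" "ys ! coord_index i = x $ i" for i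
      using inv_f_f[OF inj_coord_index, of i] coord_index_less_card[of i] by (auto simp: ys_def)
    have nth: "\<exists>i. p = coord_index i \<and> ys ! p = x $ i" if "p < length ys" for p
      using that coord_index_exhaust[of p, where 'n = 'n] ys by metis
    have "generic m ys"
      unfolding generic_def sorted_wrt_iff_nth_less
    proof (intro conjI allI impI ballI)
      fix p q assume "p < q" "q < length ys"
      then obtain i j where "p = coord_index i" "ys ! p = x $ i" "q = coord_index j" "ys ! q = x $ j"
        using nth[of p] nth[of q] by auto
      then show "ys ! p > ys ! q"
        using \<open>p < q\<close> x(1) by (simp add: regular_point_def coord_index_less_iff)
    next
      fix y z k assume *: "y \<in> set ys" "z \<in> set ys" "k \<in> {1..<m}"
      then obtain i j where ij: "y = x $ i" "z = x $ j"
        using nth by (metis in_set_conv_nth)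
      show "y - z \<noteq> real k"
      proof (cases i j rule: linorder_cases)
        case less
        then show ?thesis using x(1) * ij by (auto simp: regular_point_def)
      next
        case greater
        then have "y < z" using x(1) ij by (auto simp: regular_point_def)
        then show ?thesis by simp
      qed (use * ij in auto)
    qed
    moreover have len: "length ys = Suc (CARD('n) - 1)" using ys by simp
    ultimately obtain xs where xs: "xs \<in> configs m (CARD('n) - 1)" "same_signs m xs ys"
      using configs_exhaust_signs[OF assms] by blast
    have "cell m (signs (point_of xs)) = cell m (signs (point_of ys :: real ^ 'n::{finite,linorder}))"
      using cell_point_of_eq_iff[OF config[OF xs(1)] \<open>generic m ys\<close> ys(1)] xs(2) by blast
    also have "\<dots> = F"
      unfolding x(2) by (rule cell_cong) (simp add: signs_def point_of_diff ys)
    finally show ?thesis using xs(1) by blast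
  qed
  moreover have "cell m (signs (point_of xs)) \<in> (Flat m :: (real ^ 'n::{finite,linorder}) set set)"
    if "xs \<in> configs m (CARD('n) - 1)" for xs
    using regular_point_of[OF config[OF that]] by (auto simp: Flat_iff)
  moreover have "inj_on (\<lambda>xs. cell m (signs (point_of xs :: real ^ 'n::{finite,linorder}))) (configs m (CARD('n) - 1))"
    by (rule inj_onI) (metis cell_point_of_eq_iff config configs_inj_signs)
  ultimately show ?thesis
    unfolding bij_betw_def by blast
qed

lemma card_ties_point_of:
  assumes "length xs = CARD('n)"
  shows "card (ties m (point_of xs :: real ^ 'n::{finite,linorder})) = card (tie_pairs m xs)"
proof -
  have "tie_pairs m xs = map_prod coord_index coord_index ` ties m (point_of xs :: real ^ 'n::{finite,linorder})"
  proof (intro set_eqI iffI)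
    fix r assume r: "r \<in> tie_pairs m xs"
    obtain p q where pq: "r = (p, q)" by (cases r)
    then obtain i j :: 'n where "p = coord_index i" "q = coord_index j"
      using r assms coord_index_exhaust[where 'n = 'n] unfolding tie_pairs_def
      by (metis (mono_tags, lifting) case_prodD less_trans mem_Collect_eq)
    then show "r \<in> map_prod coord_index coord_index ` ties m (point_of xs :: real ^ 'n::{finite,linorder})"
      using r pq by (auto simp: tie_pairs_def ties_def point_of_diff coord_index_less_iff
          intro!: image_eqI[of _ _ "(i, j)"])
  qed (auto simp: tie_pairs_def ties_def point_of_diff coord_index_less_iff assms coord_index_less_card)
  moreover have "inj (map_prod coord_index coord_index :: 'n \<times> 'n \<Rightarrow> _)"
    by (rule prod.inj_map) (rule inj_coord_index)+
  ultimately show ?thesis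
    by (simp add: card_image inj_on_subset)
qed

lemma card_gaps_point_of:
  assumes "length xs = CARD('n)"
  shows "card (gaps m (point_of xs :: real ^ 'n::{finite,linorder})) = card (wide_gaps m xs)"
proof -
  have "wide_gaps m xs = (coord_index \<circ> fst) ` gaps m (point_of xs :: real ^ 'n::{finite,linorder})"
  proof (intro set_eqI iffI)
    fix p assume p: "p \<in> wide_gaps m xs"
    then obtain i j :: 'n where "p = coord_index i" "Suc p = coord_index j"
      using assms coord_index_exhaust[where 'n = 'n] unfolding wide_gaps_def
      by (metis (mono_tags, lifting) Suc_lessD mem_Collect_eq)
    then show "p \<in> (coord_index \<circ> fst) ` gaps m (point_of xs :: real ^ 'n::{finite,linorder})"
      using p by (auto simp: wide_gaps_def gaps_def point_of_diff consecutive_iff_coord_index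
          intro!: image_eqI[of _ _ "(i, j)"])
  next
    fix p assume "p \<in> (coord_index \<circ> fst) ` gaps m (point_of xs :: real ^ 'n::{finite,linorder})"
    then obtain i j :: 'n where "p = coord_index i" "coord_index j = Suc (coord_index i)" "xs ! coord_index i - xs ! coord_index j > real m"
      by (auto simp: gaps_def point_of_diff consecutive_iff_coord_index)
    then show "p \<in> wide_gaps m xs"
      using coord_index_less_card[of j] assms by (simp add: wide_gaps_def)
  qed
  \<comment> \<open>The first index of a consecutive pair determines the second.\<close>
  moreover have "inj_on (coord_index \<circ> fst) (gaps m (point_of xs :: real ^ 'n::{finite,linorder}))"
  proof (rule inj_onI)
    fix a b assume *: "a \<in> gaps m (point_of xs :: real ^ 'n::{finite,linorder})" "b \<in> gaps m (point_of xs :: real ^ 'n::{finite,linorder})"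
      "(coord_index \<circ> fst) a = (coord_index \<circ> fst) b"
    then have "coord_index (fst a) = coord_index (fst b)" "coord_index (snd a) = coord_index (snd b)"
      by (auto simp: gaps_def consecutive_iff_coord_index)
    then show "a = b"
      using inj_coord_index by (auto simp: prod_eq_iff dest: injD)
  qed
  ultimately show ?thesis
    by (simp only: card_image)
qed

section \<open>Comparison of both sides under \<open>t = 1 / x\<close> and
  \<open>u = y / x\<close>\<close>

theorem proposition5p5:
  fixes m n :: nat and x y :: "'a::field"
  assumes "m > 0" and "n = CARD('n::{finite,linorder})"
    and "x \<noteq> 0" and "x + 1 \<noteq> 0"
  shows "x ^ (n - 1) * dyck_poly m n ((x + 1) / x) ((y + 1) / (x + 1)) =
    (\<Sum>F\<in>(Flat m :: (real ^ 'n::{finite,linorder}) set set). x powi (aff_dim F - int (ssw m F)) * y ^ ssw m F)"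
proof -
  have n: "n > 0" using assms(2) by simp
  let ?cell = "\<lambda>xs. cell m (signs (point_of xs :: real ^ 'n::{finite,linorder}))"
  \<comment> \<open>With \<open>a\<close> ties and \<open>b\<close> wide gaps the flat contributes
    \<open>x powi (n - 1 - a - b) * y ^ b\<close>, which is \<open>x ^ (n - 1)\<close> times
    \<open>(1 / x) ^ a * (y / x) ^ b\<close>.\<close>
  have weight: "x powi (aff_dim (?cell xs) - int (ssw m (?cell xs))) * y ^ ssw m (?cell xs) =
      x ^ (n - 1) * config_weight m (1 / x) (y / x) xs"
    if "xs \<in> configs m (n - 1)" for xs
  proof -
    have xs: "generic m xs" "length xs = CARD('n)"
      using configs_generic[OF that] assms(2) by auto
    note reg = regular_point_of[OF xs]
    define a b where "a = card (tie_pairs m xs)" and "b = card (wide_gaps m xs)"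
    have "aff_dim (?cell xs) = int (n - 1) - int a"
      using aff_dim_Flat[OF assms(1) reg] n
      by (simp add: card_ties_point_of[OF xs(2)] a_def assms(2) of_nat_diff)
    moreover have "ssw m (?cell xs) = b"
      using ssw_eq[OF assms(1) reg] by (simp add: card_gaps_point_of[OF xs(2)] b_def)
    moreover have "x powi (int (n - 1) - int a - int b) = x ^ (n - 1) / (x ^ a * x ^ b)"
      using assms(3) by (simp add: power_int_diff)
    ultimately show ?thesis
      using assms(3) by (simp add: config_weight_eq[OF xs(1)] a_def b_def power_divide)
  qed
  have "(\<Sum>F\<in>(Flat m :: (real ^ 'n::{finite,linorder}) set set). x powi (aff_dim F - int (ssw m F)) * y ^ ssw m F) =
      (\<Sum>xs\<in>configs m (n - 1). x powi (aff_dim (?cell xs) - int (ssw m (?cell xs))) * y ^ ssw m (?cell xs))"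
    using sum.reindex_bij_betw[OF bij_betw_configs_Flat[OF assms(1), where 'n = 'n], symmetric] assms(2)
    by simp
  also have "\<dots> = x ^ (n - 1) * (\<Sum>xs\<in>configs m (n - 1). config_weight m (1 / x) (y / x) xs)"
    by (simp add: weight sum_distrib_left)
  also have "\<dots> = x ^ (n - 1) * slot_sum m (1 + 1 / x) (1 / x + y / x) (n - 1) (replicate m 1)"
    by (simp only: sum_configs_eq_slot_sum[OF assms(1)])
  \<comment> \<open>The parameters match those of the paths: \<open>1 + t\<close> is the weight of a
    counted valley, and \<open>t + u\<close> is the product of both arguments of the polynomial, the
    weight of a return.\<close>
  also have "1 + 1 / x = (x + 1) / x"
    using assms(3) by (simp add: field_simps)
  also have "1 / x + y / x = (x + 1) / x * ((y + 1) / (x + 1))"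
    using assms(3,4) by (simp add: times_divide_times_eq add_divide_distrib[symmetric] add.commute)
  also have "slot_sum m ((x + 1) / x) ((x + 1) / x * ((y + 1) / (x + 1))) (n - 1) (replicate m 1) =
      dyck_poly m n ((x + 1) / x) ((y + 1) / (x + 1))"
    by (rule dyck_poly_eq_slot_sum[OF assms(1) n, symmetric])
  finally show ?thesis by (rule sym)
qed

end
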